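(* Let $\alpha_1,\dots,\alpha_n$ be regular planar curves in $\mathbb{C}$ parametrized by arclength, and let $\Phi(s_1,\dots,s_n)=(\alpha_1(s_1),\dots,\alpha_n(s_n))\in\mathbb{C}^n$ be their product immersion. Then: (a) $\Phi$ has parallel mean curvature vector if and only if each curve $\alpha_j$ is either a circle or a straight line. (b) $\Phi$ is H-minimal if and only if (i) each curve $\alpha_j$ is either a circle, a line, or a Cornu spiral of parameter $\lambda_j$, and (ii) $\sum_{j=1}^n\lambda_j=0$, where one sets $\lambda_j=0$ if $\alpha_j$ is a circle or a line.
   Context: The product of $n$ regular planar curves is a Lagrangian immersion into $\mathbb{C}^n$ (it pulls back the standard symplectic form to $0$). The mean curvature vector is $H=\frac1n\mathrm{trace}\,\sigma$, $\sigma$ the second fundamental form; it is parallel if $\nabla^\perp H=0$ in the normal bundle. A Lagrangian immersion is H-minimal (Hamiltonian-minimal) if it is a critical point of the volume for compactly supported Hamiltonian variations; equivalently $\mathrm{div}\,JH=0$, where $J$ is multiplication by $i$; equivalently its Lagrangian angle $\beta=\arg\,(dz_1\wedge\dots\wedge dz_n)(e_1,\dots,e_n)$ ($(e_j)$ an oriented tangent frame) is harmonic for the induced metric. A Cornu spiral of parameter $\lambda\neq0$ is a planar curve whose signed curvature is an affine function $\kappa(s)=\lambda s+\mu$ of its arclength parameter; up to translation of the parameter and orientation-preserving congruences it is $s\mapsto\big(\int_0^s\cos(\lambda t^2/2)\,dt,\int_0^s\sin(\lambda t^2/2)\,dt\big)$. The curves are defined on intervals, and "is a circle / line / Cornu spiral"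 means that the curve is an arc of such a curve. *)

theory Defs
  imports "HOL-Analysis.Analysis"
begin

text \<open>
  For an open set \<open>S\<close> in a Euclidean space, \<open>Ck_on k S f\<close> says that \<open>f\<close> is of class
  \<open>C\<^sup>k\<close> on \<open>S\<close>: directional derivatives of order at most \<open>k\<close> exist and are continuous.
\<close>

primrec Ck_on ::
    "nat \<Rightarrow> 'a::euclidean_space set \<Rightarrow> ('a \<Rightarrow> 'b::real_normed_vector) \<Rightarrow> bool" where
  "Ck_on 0 S f \<longleftrightarrow> continuous_on S f"
| "Ck_on (Suc k) S f \<longleftrightarrow> (\<forall>x\<in>S. f differentiable (at x)) \<and>
     (\<forall>v. Ck_on k S (\<lambda>x. frechet_derivative f (at x) v))"

definition smooth_on ::
    "'a::euclidean_space set \<Rightarrow> ('a \<Rightarrow> 'b::real_normed_vector) \<Rightarrow> bool" where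
  "smooth_on S f \<longleftrightarrow> (\<forall>k. Ck_on k S f)"

definition arclength_curve :: "real set \<Rightarrow> (real \<Rightarrow> complex) \<Rightarrow> bool" where
  "arclength_curve I \<alpha> \<longleftrightarrow> open I \<and> is_interval I \<and> I \<noteq> {} \<and> smooth_on I \<alpha> \<and>
     (\<forall>s\<in>I. norm (vector_derivative \<alpha> (at s)) = 1)"

text \<open>
  For a curve parametrized by arclength, \<open>\<alpha>'' = \<kappa> \<i> \<alpha>'\<close>; the inner product below is the real
  one on the plane.
\<close>

definition signed_curvature :: "(real \<Rightarrow> complex) \<Rightarrow> real \<Rightarrow> real" where
  "signed_curvature \<alpha> s =
     vector_derivative (\<lambda>u. vector_derivative \<alpha> (at u)) (at s)
       \<bullet> (\<i> * vector_derivative \<alpha> (at s))"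

definition is_circle_on :: "real set \<Rightarrow> (real \<Rightarrow> complex) \<Rightarrow> bool" where
  "is_circle_on I \<alpha> \<longleftrightarrow> (\<exists>c r. r > 0 \<and> \<alpha> ` I \<subseteq> sphere c r)"

definition is_line_on :: "real set \<Rightarrow> (real \<Rightarrow> complex) \<Rightarrow> bool" where
  "is_line_on I \<alpha> \<longleftrightarrow> (\<exists>p v. v \<noteq> 0 \<and> \<alpha> ` I \<subseteq> range (\<lambda>t. p + t *\<^sub>R v))"

text \<open>Meant for curves parametrized by arclength.\<close>

definition is_cornu_spiral_on :: "real \<Rightarrow> real set \<Rightarrow> (real \<Rightarrow> complex) \<Rightarrow> bool" where
  "is_cornu_spiral_on l I \<alpha> \<longleftrightarrow> l \<noteq> 0 \<and> (\<exists>m. \<forall>s\<in>I. signed_curvature \<alpha> s = l * s + m)"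

definition partial_deriv ::
    "'n::finite \<Rightarrow> (real^'n \<Rightarrow> 'e::real_normed_vector) \<Rightarrow> real^'n \<Rightarrow> 'e" where
  "partial_deriv j F s = frechet_derivative F (at s) (axis j 1)"

definition induced_metric ::
    "(real^'n::finite \<Rightarrow> 'e::euclidean_space) \<Rightarrow> real^'n \<Rightarrow> real^'n^'n" where
  "induced_metric F s = (\<chi> j k. partial_deriv j F s \<bullet> partial_deriv k F s)"

definition tangent_space ::
    "(real^'n::finite \<Rightarrow> 'e::euclidean_space) \<Rightarrow> real^'n \<Rightarrow> 'e set" where
  "tangent_space F s = range (frechet_derivative F (at s))"

definition normal_part ::
    "(real^'n::finite \<Rightarrow> 'e::euclidean_space) \<Rightarrow> real^'n \<Rightarrow> 'e \<Rightarrow> 'e" where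
  "normal_part F s w =
     (THE u. u \<in> (tangent_space F s)\<^sup>\<bottom> \<and> w - u \<in> tangent_space F s)"

text \<open>
  Components of the second fundamental form in the coordinate frame: the normal part of the
  derivative in the flat ambient space.
\<close>

definition second_fundamental_form ::
    "(real^'n::finite \<Rightarrow> 'e::euclidean_space) \<Rightarrow> 'n \<Rightarrow> 'n \<Rightarrow> real^'n \<Rightarrow> 'e" where
  "second_fundamental_form F j k s =
     normal_part F s (partial_deriv j (partial_deriv k F) s)"

definition mean_curvature ::
    "(real^'n::finite \<Rightarrow> 'e::euclidean_space) \<Rightarrow> real^'n \<Rightarrow> 'e" where
  "mean_curvature F s = (1 / real CARD('n)) *\<^sub>R
     (\<Sum>j\<in>UNIV. \<Sum>k\<in>UNIV.
        (matrix_inv (induced_metric F s) $ j $ k) *\<^sub>R second_fundamental_form F j k s)"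

text \<open>The normal connection is the normal part of the flat ambient derivative.\<close>

definition parallel_mean_curvature ::
    "(real^'n::finite) set \<Rightarrow> (real^'n \<Rightarrow> 'e::euclidean_space) \<Rightarrow> bool" where
  "parallel_mean_curvature \<Omega> F \<longleftrightarrow>
     (\<forall>s\<in>\<Omega>. \<forall>j. normal_part F s (partial_deriv j (mean_curvature F) s) = 0)"

text \<open>
  The inner product is the real one on the underlying \<open>2n\<close>-dimensional real space, so this
  is the form \<open>\<Sum>\<^sub>j dx\<^sub>j \<and> dy\<^sub>j\<close>.
\<close>

definition symplectic_form :: "complex^'n::finite \<Rightarrow> complex^'n \<Rightarrow> real" where
  "symplectic_form v w = (\<i> *s v) \<bullet> w"

definition lagrangian_immersion ::
    "(real^'n::finite) set \<Rightarrow> (real^'n \<Rightarrow> complex^'n) \<Rightarrow> bool" where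
  "lagrangian_immersion \<Omega> F \<longleftrightarrow> open \<Omega> \<and> smooth_on \<Omega> F \<and>
     (\<forall>s\<in>\<Omega>. inj (frechet_derivative F (at s)) \<and>
        (\<forall>v w. symplectic_form (frechet_derivative F (at s) v)
                               (frechet_derivative F (at s) w) = 0))"

text \<open>
  \<open>G\<close> is a smooth variation of \<open>F\<close> supported in the compact set \<open>K\<close> whose variation field
  \<open>V\<close> at time \<open>0\<close> is Hamiltonian: the one-form obtained by contracting the symplectic form
  with \<open>V\<close> and restricting to tangent vectors is \<open>df\<close> for some smooth \<open>f\<close> supported in
  \<open>K\<close>. If \<open>V\<close> is normal this amounts to \<open>V\<close> being \<open>\<i>\<close> times the gradient of a
  compactly supported function (up to sign); tangential components of \<open>V\<close> are allowed.
\<close>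

definition hamiltonian_variation ::
    "(real^'n::finite) set \<Rightarrow> (real^'n \<Rightarrow> complex^'n) \<Rightarrow> (real^'n) set \<Rightarrow>
     (real \<Rightarrow> real^'n \<Rightarrow> complex^'n) \<Rightarrow> bool" where
  "hamiltonian_variation \<Omega> F K G \<longleftrightarrow>
     compact K \<and> K \<subseteq> \<Omega> \<and>
     (\<exists>\<epsilon>>0. smooth_on ({-\<epsilon><..<\<epsilon>} \<times> \<Omega>) (\<lambda>(t, s). G t s) \<and>
        (\<forall>t\<in>{-\<epsilon><..<\<epsilon>}. \<forall>s\<in>\<Omega> - K. G t s = F s)) \<and>
     (\<forall>s\<in>\<Omega>. G 0 s = F s) \<and>
     (\<exists>f :: real^'n \<Rightarrow> real. smooth_on \<Omega> f \<and> (\<forall>s\<in>\<Omega> - K. f s = 0) \<and>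
        (\<forall>s\<in>\<Omega>. \<forall>v.
           symplectic_form (vector_derivative (\<lambda>t. G t s) (at 0))
                           (frechet_derivative F (at s) v)
             = frechet_derivative f (at s) v))"

definition volume_on ::
    "(real^'n::finite) set \<Rightarrow> (real^'n \<Rightarrow> 'e::euclidean_space) \<Rightarrow> real" where
  "volume_on K F = integral K (\<lambda>s. sqrt (det (induced_metric F s)))"

text \<open>
  The total volume may be infinite, so the volume is taken over a compact set outside of
  which the variation is constant.
\<close>

definition H_minimal ::
    "(real^'n::finite) set \<Rightarrow> (real^'n \<Rightarrow> complex^'n) \<Rightarrow> bool" where
  "H_minimal \<Omega> F \<longleftrightarrow> lagrangian_immersion \<Omega> F \<and>
     (\<forall>K G. hamiltonian_variation \<Omega> F K G \<longrightarrow>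
        ((\<lambda>t. volume_on K (G t)) has_real_derivative 0) (at 0))"

definition product_domain :: "('n::finite \<Rightarrow> real set) \<Rightarrow> (real^'n) set" where
  "product_domain I = {s. \<forall>j. s $ j \<in> I j}"

definition product_immersion ::
    "('n::finite \<Rightarrow> real \<Rightarrow> complex) \<Rightarrow> real^'n \<Rightarrow> complex^'n" where
  "product_immersion \<alpha> s = (\<chi> j. \<alpha> j (s $ j))"

end

theory Submission
  imports Defs
begin

text \<open>
  For curves parametrized by arclength the product immersion \<open>\<Phi>\<close> induces the Euclidean metric, with
  orthonormal tangent frame \<open>T\<^sub>j = \<alpha>\<^sub>j'\<close> and normal frame \<open>\<i> T\<^sub>j\<close>, one pair in each complex coordinate.
  By the Frenet equation \<open>T\<^sub>j' = \<kappa>\<^sub>j \<i> T\<^sub>j\<close> the mean curvature vector is \<open>(1/n) \<Sum>\<^sub>j \<kappa>\<^sub>j \<i> T\<^sub>j\<close>, and the normal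
  part of its \<open>k\<close>-th derivative is \<open>(1/n) \<kappa>\<^sub>k' \<i> T\<^sub>k\<close>
  (\<open>normal_derivative_mean_curvature\<close>). So it is parallel exactly if all curvatures are constant,
  that is, if all curves are circles or lines (\<open>circle_or_line_iff\<close>).

  For a Hamiltonian variation with Hamiltonian \<open>f\<close> of compact support, the first variation of the
  volume is \<open>- \<integral> (\<Sum>\<^sub>j \<kappa>\<^sub>j') f\<close> (\<open>hamiltonian_volume_variation\<close>). One integration by parts turns the
  derivative of the volume into the pairing of the variation field with the mean curvature
  (\<open>volume_variation\<close>); a second one, after inserting that the normal components of the field are
  up to sign the derivatives of \<open>f\<close>, moves those derivatives to the curvatures. Both rest on the
  fact that a derivative of a compactly supported function has integral zero
  (\<open>integral_derivative_compact_support\<close>).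

  Every smooth \<open>f\<close> of compact support occurs (\<open>exists_hamiltonian_variation\<close>), bump functions among
  them, so H-minimality means that \<open>\<Sum>\<^sub>j \<kappa>\<^sub>j'(s\<^sub>j)\<close> vanishes on the product of the intervals. As the
  coordinates vary independently, each \<open>\<kappa>\<^sub>j'\<close> is then a constant \<open>\<lambda>\<^sub>j\<close>, and these constants sum to
  zero. Curvature of constant slope \<open>\<lambda>\<^sub>j\<close> characterizes Cornu spirals if \<open>\<lambda>\<^sub>j \<noteq> 0\<close>, and circles
  and lines if \<open>\<lambda>\<^sub>j = 0\<close> (\<open>affine_curvature_iff\<close>).
\<close>

section \<open>Calculus of smooth functions\<close>

lemma has_frechet_derivative:
  assumes "f differentiable (at x)"
  shows "(f has_derivative frechet_derivative f (at x)) (at x)"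
  using assms frechet_derivative_works by blast

text \<open>
  A Frechet derivative at a point of an open set sees the function on that set only, so the
  class \<open>C\<^sup>k\<close> on an open set is insensitive to the values outside. This is what lets a derivative
  known in closed form on the domain replace the total function \<^const>\<open>frechet_derivative\<close>.
\<close>

lemma Ck_on_cong:
  assumes "open S" "\<And>x. x \<in> S \<Longrightarrow> f x = g x"
  shows "Ck_on k S f \<longleftrightarrow> Ck_on k S g"
  using assms(2)
proof (induction k arbitrary: f g)
  case 0
  then show ?case by (simp cong: continuous_on_cong)
next
  case (Suc k)
  have iff: "f differentiable (at x) \<longleftrightarrow> g differentiable (at x)" if "x \<in> S" for x
    using that Suc.prems \<open>open S\<close> unfolding differentiable_def
    by (metis has_derivative_transform_within_open)
  show ?case
  proof (cases "\<forall>x\<in>S. f differentiable (at x)")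
    case True
    have "frechet_derivative f (at x) = frechet_derivative g (at x)" if "x \<in> S" for x
      using that True Suc.prems \<open>open S\<close> frechet_derivative_transform_within_open by blast
    then show ?thesis
      using Suc.IH[of "\<lambda>x. frechet_derivative f (at x) v" "\<lambda>x. frechet_derivative g (at x) v" for v] iff
      by auto
  next
    case False
    then show ?thesis using iff by auto
  qed
qed

lemma Ck_on_SucI:
  assumes "open S" "\<And>x. x \<in> S \<Longrightarrow> (f has_derivative f' x) (at x)"
    and "\<And>v. Ck_on k S (\<lambda>x. f' x v)"
  shows "Ck_on (Suc k) S f"
proof -
  have "frechet_derivative f (at x) = f' x" if "x \<in> S" for x
    using assms(2) that frechet_derivative_at by metis
  then have "Ck_on k S (\<lambda>x. frechet_derivative f (at x) v)" for v
    using assms(3)[of v] Ck_on_cong[OF assms(1), of "\<lambda>x. frechet_derivative f (at x) v" "\<lambda>x. f' x v" k]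
    by simp
  then show ?thesis using assms(2) by (auto simp: differentiable_def)
qed

lemma Ck_on_SucD:
  assumes "Ck_on (Suc k) S f"
  shows "Ck_on k S f"
  using assms
proof (induction k arbitrary: f)
  case 0
  then show ?case
    by (auto intro!: continuous_at_imp_continuous_on differentiable_imp_continuous_within)
next
  case (Suc k)
  then show ?case by simp
qed

lemma Ck_on_subset: "Ck_on k S f \<Longrightarrow> T \<subseteq> S \<Longrightarrow> Ck_on k T f"
  by (induction k arbitrary: f) (auto intro: continuous_on_subset)

lemma Ck_on_const: "Ck_on k S (\<lambda>x. c)"
  by (induction k arbitrary: c) auto

lemma Ck_on_add:
  assumes "open S" "Ck_on k S f" "Ck_on k S g"
  shows "Ck_on k S (\<lambda>x. f x + g x)"
  using assms(2,3)
proof (induction k arbitrary: f g)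
  case (Suc k)
  show ?case
    by (rule Ck_on_SucI[OF \<open>open S\<close>, where
        f' = "\<lambda>x v. frechet_derivative f (at x) v + frechet_derivative g (at x) v"])
      (use Suc in \<open>auto intro!: has_derivative_add has_frechet_derivative\<close>)
qed (auto intro: continuous_intros)

lemma Ck_on_sum:
  assumes "open S" "\<And>i. i \<in> A \<Longrightarrow> Ck_on k S (f i)"
  shows "Ck_on k S (\<lambda>x. \<Sum>i\<in>A. f i x)"
  using assms(2)
  by (induction A rule: infinite_finite_induct)
    (simp_all add: Ck_on_const Ck_on_add assms(1) del: Ck_on.simps)

lemma Ck_on_linear_compose:
  assumes "open S" "bounded_linear L" "Ck_on k S f"
  shows "Ck_on k S (\<lambda>x. L (f x))"
  using assms(3)
proof (induction k arbitrary: f)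
  case 0
  then show ?case by (auto intro!: bounded_linear.continuous_on[OF assms(2)])
next
  case (Suc k)
  show ?case
    by (rule Ck_on_SucI[OF \<open>open S\<close>, where f' = "\<lambda>x v. L (frechet_derivative f (at x) v)"])
      (use Suc in \<open>auto intro!: bounded_linear.has_derivative[OF assms(2)] has_frechet_derivative\<close>)
qed

lemma Ck_on_bilinear:
  assumes "open S" "bounded_bilinear B" "Ck_on k S f" "Ck_on k S g"
  shows "Ck_on k S (\<lambda>x. B (f x) (g x))"
  using assms(3,4)
proof (induction k arbitrary: f g)
  case 0
  then show ?case by (auto intro: bounded_bilinear.continuous_on[OF assms(2)])
next
  case (Suc k)
  have "Ck_on k S f" "Ck_on k S g" using Suc.prems Ck_on_SucD by blast+
  then show ?case
    by (intro Ck_on_SucI[OF \<open>open S\<close>, where f' = "\<lambda>x v. B (f x) (frechet_derivative g (at x) v)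
          + B (frechet_derivative f (at x) v) (g x)"])
      (use Suc in \<open>auto intro!: bounded_bilinear.FDERIV[OF assms(2)] has_frechet_derivative
          Ck_on_add[OF \<open>open S\<close>]\<close>)
qed

lemma Ck_on_compose_affine:
  assumes "open S" and g: "\<And>x. (g has_derivative L) (at x)"
    and f: "Ck_on k T f" and ST: "\<And>x. x \<in> S \<Longrightarrow> g x \<in> T"
  shows "Ck_on k S (\<lambda>x. f (g x))"
  using f
proof (induction k arbitrary: f)
  case 0
  have "continuous_on S g"
    using g by (meson continuous_at_imp_continuous_on has_derivative_continuous)
  then show ?case using 0 continuous_on_compose2[of T f S g] ST by auto
next
  case (Suc k)
  show ?case
    by (rule Ck_on_SucI[OF \<open>open S\<close>, where f' = "\<lambda>x v. frechet_derivative f (at (g x)) (L v)"])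
      (use Suc ST in \<open>auto intro!: has_derivative_compose[OF g] has_frechet_derivative\<close>)
qed

text \<open>
  With an outer function of one real variable the derivative of the composite is a single
  product, so the induction on \<open>k\<close> closes with the product rule alone.
\<close>

lemma Ck_on_compose_real:
  fixes h :: "real \<Rightarrow> 'b::real_normed_vector"
  assumes "open S" "Ck_on k T h" "Ck_on k S q" "\<And>x. x \<in> S \<Longrightarrow> q x \<in> T"
  shows "Ck_on k S (\<lambda>x. h (q x))"
  using assms(2,3)
proof (induction k arbitrary: h)
  case 0
  then show ?case using assms(4) by (auto intro!: continuous_on_compose2[of T h])
next
  case (Suc k)
  have "Ck_on k S q" using Suc.prems Ck_on_SucD by blast
  show ?case
  proof (rule Ck_on_SucI[OF \<open>open S\<close>, where
        f' = "\<lambda>x v. frechet_derivative q (at x) v *\<^sub>R frechet_derivative h (at (q x)) 1"])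
    fix x assume "x \<in> S"
    have h: "h differentiable (at (q x))" and q: "q differentiable (at x)"
      using Suc.prems \<open>x \<in> S\<close> assms(4) by auto
    have "((\<lambda>x. h (q x)) has_derivative (\<lambda>v. frechet_derivative h (at (q x)) (frechet_derivative q (at x) v))) (at x)"
      using h q by (intro has_derivative_compose[of q _ _ _ h] has_frechet_derivative)
    moreover have "frechet_derivative h (at (q x)) (frechet_derivative q (at x) v)
        = frechet_derivative q (at x) v *\<^sub>R frechet_derivative h (at (q x)) 1" for v
      using linear_cmul[OF linear_frechet_derivative[OF h], of "frechet_derivative q (at x) v" 1] by simp
    ultimately show "((\<lambda>x. h (q x)) has_derivative
        (\<lambda>v. frechet_derivative q (at x) v *\<^sub>R frechet_derivative h (at (q x)) 1)) (at x)"
      by simp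
  next
    fix v
    show "Ck_on k S (\<lambda>x. frechet_derivative q (at x) v *\<^sub>R frechet_derivative h (at (q x)) 1)"
      using Suc.prems \<open>Ck_on k S q\<close>
      by (intro Ck_on_bilinear[OF \<open>open S\<close> bounded_bilinear_scaleR] Suc.IH
          [of "\<lambda>y. frechet_derivative h (at y) 1"]) auto
  qed
qed

lemma Ck_on_linear:
  assumes "bounded_linear L"
  shows "Ck_on k S L"
proof (cases k)
  case 0
  then show ?thesis using assms by (simp add: linear_continuous_on)
next
  case (Suc m)
  have "frechet_derivative L (at x) = L" for x
    using bounded_linear_imp_has_derivative[OF assms] frechet_derivative_at by metis
  then show ?thesis
    using Suc bounded_linear_imp_differentiable[OF assms] by (simp add: Ck_on_const)
qed

lemma smooth_on_cong:
  "open S \<Longrightarrow> (\<And>x. x \<in> S \<Longrightarrow> f x = g x) \<Longrightarrow> smooth_on S f \<longleftrightarrow> smooth_on S g"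
  unfolding smooth_on_def using Ck_on_cong by blast

lemma smooth_on_subset: "smooth_on S f \<Longrightarrow> T \<subseteq> S \<Longrightarrow> smooth_on T f"
  unfolding smooth_on_def using Ck_on_subset by blast

lemma smooth_on_const: "smooth_on S (\<lambda>x. c)"
  unfolding smooth_on_def by (simp add: Ck_on_const)

lemma smooth_on_add:
  "open S \<Longrightarrow> smooth_on S f \<Longrightarrow> smooth_on S g \<Longrightarrow> smooth_on S (\<lambda>x. f x + g x)"
  unfolding smooth_on_def using Ck_on_add by blast

lemma smooth_on_sum:
  "open S \<Longrightarrow> (\<And>i. i \<in> A \<Longrightarrow> smooth_on S (f i)) \<Longrightarrow> smooth_on S (\<lambda>x. \<Sum>i\<in>A. f i x)"
  by (simp add: smooth_on_def Ck_on_sum)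

lemma smooth_on_linear: "bounded_linear L \<Longrightarrow> smooth_on S L"
  unfolding smooth_on_def using Ck_on_linear by blast

lemma smooth_on_linear_compose:
  "open S \<Longrightarrow> bounded_linear L \<Longrightarrow> smooth_on S f \<Longrightarrow> smooth_on S (\<lambda>x. L (f x))"
  unfolding smooth_on_def using Ck_on_linear_compose by blast

lemma smooth_on_bilinear:
  "open S \<Longrightarrow> bounded_bilinear B \<Longrightarrow> smooth_on S f \<Longrightarrow> smooth_on S g \<Longrightarrow>
    smooth_on S (\<lambda>x. B (f x) (g x))"
  unfolding smooth_on_def using Ck_on_bilinear by blast

lemma smooth_on_prod:
  fixes f :: "'i \<Rightarrow> 'a::euclidean_space \<Rightarrow> 'b::real_normed_field"
  assumes "open S" "\<And>i. i \<in> A \<Longrightarrow> smooth_on S (f i)"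
  shows "smooth_on S (\<lambda>x. \<Prod>i\<in>A. f i x)"
  using assms(2)
  by (induction A rule: infinite_finite_induct)
    (simp_all add: smooth_on_const smooth_on_bilinear[OF assms(1) bounded_bilinear_mult])

lemma smooth_on_compose_affine:
  "open S \<Longrightarrow> (\<And>x. (g has_derivative L) (at x)) \<Longrightarrow> smooth_on T f \<Longrightarrow>
    (\<And>x. x \<in> S \<Longrightarrow> g x \<in> T) \<Longrightarrow> smooth_on S (\<lambda>x. f (g x))"
  unfolding smooth_on_def using Ck_on_compose_affine by blast

lemma smooth_on_compose_linear:
  "open S \<Longrightarrow> bounded_linear L \<Longrightarrow> smooth_on T f \<Longrightarrow> (\<And>x. x \<in> S \<Longrightarrow> L x \<in> T) \<Longrightarrow>
    smooth_on S (\<lambda>x. f (L x))"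
  by (rule smooth_on_compose_affine[OF _ bounded_linear_imp_has_derivative])

lemma smooth_on_compose_real:
  fixes h :: "real \<Rightarrow> 'b::real_normed_vector"
  shows "open S \<Longrightarrow> smooth_on T h \<Longrightarrow> smooth_on S q \<Longrightarrow> (\<And>x. x \<in> S \<Longrightarrow> q x \<in> T) \<Longrightarrow>
    smooth_on S (\<lambda>x. h (q x))"
  unfolding smooth_on_def using Ck_on_compose_real by blast

lemma smooth_on_frechet_derivative:
  "smooth_on S f \<Longrightarrow> smooth_on S (\<lambda>x. frechet_derivative f (at x) v)"
  unfolding smooth_on_def by (metis Ck_on.simps(2))

lemma smooth_on_continuous_on: "smooth_on S f \<Longrightarrow> continuous_on S f"
  unfolding smooth_on_def by (metis Ck_on.simps(1))

lemma smooth_on_differentiable: "smooth_on S f \<Longrightarrow> x \<in> S \<Longrightarrow> f differentiable (at x)"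
  unfolding smooth_on_def by (metis Ck_on.simps(2))

text \<open>bump\<close>

text \<open>
  The family \<open>x \<mapsto> x\<^bsup>-k\<^esup> exp (-1/x)\<close>, extended by \<open>0\<close> to \<open>x \<le> 0\<close>, contains the standard flat
  function (\<open>k = 0\<close>) and its span is closed under differentiation. So all members are \<open>C\<^sup>m\<close> by a
  single induction on \<open>m\<close>, with no closed form for higher derivatives.
\<close>

definition flat_exp :: "nat \<Rightarrow> real \<Rightarrow> real" where
  "flat_exp k x = (if x > 0 then exp (- (1 / x)) / x ^ k else 0)"

lemma flat_exp_tendsto_0: "((\<lambda>x. exp (- (1 / x)) / x ^ k) \<longlongrightarrow> 0) (at_right (0::real))"
proof -
  have "((\<lambda>x. inverse x ^ k / exp (inverse x)) \<longlongrightarrow> 0) (at_right (0::real))"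
    by (rule filterlim_compose[OF tendsto_power_div_exp_0 filterlim_inverse_at_top_right])
  moreover have "(\<lambda>x::real. inverse x ^ k / exp (inverse x)) = (\<lambda>x. exp (- (1 / x)) / x ^ k)"
    by (auto simp: exp_minus field_simps)
  ultimately show ?thesis by simp
qed

text \<open>
  At \<open>0\<close> the difference quotient of the \<open>k\<close>-th member is the member \<open>k + 1\<close>, which tends to \<open>0\<close>
  because the exponential beats every power.
\<close>

lemma flat_exp_has_derivative:
  "(flat_exp k has_real_derivative flat_exp (k + 2) x - real k * flat_exp (k + 1) x) (at x)"
proof -
  consider "x > 0" | "x < 0" | "x = 0" by linarith
  then show ?thesis
  proof cases
    case 1
    have "((\<lambda>x. exp (- (1 / x)) / x ^ k) has_real_derivative
        flat_exp (k + 2) x - real k * flat_exp (k + 1) x) (at x)"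
    proof (rule DERIV_cong)
      show "((\<lambda>x. exp (- (1 / x)) / x ^ k) has_real_derivative
          (exp (- (1 / x)) * (1 / (x * x)) * x ^ k - exp (- (1 / x)) * (real k * x ^ (k - 1)))
            / (x ^ k * x ^ k)) (at x)"
        using 1 by (auto intro!: derivative_eq_intros)
      have "real k * x ^ (k - 1) = real k * x ^ k / x" using 1 by (cases k) auto
      then show "(exp (- (1 / x)) * (1 / (x * x)) * x ^ k - exp (- (1 / x)) * (real k * x ^ (k - 1)))
          / (x ^ k * x ^ k) = flat_exp (k + 2) x - real k * flat_exp (k + 1) x"
        using 1 by (simp only:) (simp add: flat_exp_def field_simps)
    qed
    then show ?thesis
      by (rule has_field_derivative_transform_within_open[where S = "{0<..}"])
        (use 1 in \<open>auto simp: flat_exp_def\<close>)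
  next
    case 2
    have "((\<lambda>x. 0) has_real_derivative 0) (at x)" by simp
    then have "(flat_exp k has_real_derivative 0) (at x)"
      by (rule has_field_derivative_transform_within_open[where S = "{..<0}"])
        (use 2 in \<open>auto simp: flat_exp_def\<close>)
    then show ?thesis using 2 by (simp add: flat_exp_def)
  next
    case 3
    have "((\<lambda>h. flat_exp (Suc k) h) \<longlongrightarrow> 0) (at_right 0)"
      by (rule Lim_transform_eventually[OF flat_exp_tendsto_0[of "Suc k"]])
        (auto simp: eventually_at_right_field flat_exp_def intro!: exI[of _ 1])
    moreover have "((\<lambda>h. flat_exp (Suc k) h) \<longlongrightarrow> 0) (at_left 0)"
      by (rule tendsto_eventually) (auto simp: eventually_at_left_field flat_exp_def intro!: exI[of _ "-1"])
    ultimately have "((\<lambda>h. flat_exp (Suc k) h) \<longlongrightarrow> 0) (at 0)"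
      by (simp add: filterlim_at_split)
    moreover have "(flat_exp k (0 + h) - flat_exp k 0) / h = flat_exp (Suc k) h" for h
      by (simp add: flat_exp_def)
    ultimately show ?thesis using 3 by (simp add: DERIV_def flat_exp_def)
  qed
qed

lemma flat_exp_smooth: "smooth_on UNIV (flat_exp k)"
proof -
  have "Ck_on m UNIV (flat_exp k)" for m
  proof (induction m arbitrary: k)
    case 0
    then show ?case
      by (auto intro!: continuous_at_imp_continuous_on DERIV_isCont flat_exp_has_derivative)
  next
    case (Suc m)
    show ?case
    proof (rule Ck_on_SucI)
      show "(flat_exp k has_derivative
          (\<lambda>v. (flat_exp (k + 2) x - real k * flat_exp (k + 1) x) * v)) (at x)" for x
        using flat_exp_has_derivative has_field_derivative_def by blast
      have "Ck_on m UNIV (\<lambda>x. v * flat_exp (k + 2) x + (- v * real k) * flat_exp (k + 1) x)" for v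
        by (intro Ck_on_add Ck_on_linear_compose[OF _ bounded_linear_mult_right] Suc open_UNIV)
      then show "Ck_on m UNIV (\<lambda>x. (flat_exp (k + 2) x - real k * flat_exp (k + 1) x) * v)" for v
        by (simp add: algebra_simps)
    qed simp
  qed
  then show ?thesis by (simp add: smooth_on_def)
qed

lemma exists_smooth_bump:
  fixes x0 :: "'a::euclidean_space"
  assumes "r > 0"
  obtains f :: "'a \<Rightarrow> real" where "smooth_on UNIV f" "\<And>x. f x \<ge> 0" "f x0 > 0"
    "\<And>x. x \<notin> cball x0 r \<Longrightarrow> f x = 0"
proof
  define f where "f x = flat_exp 0 (r\<^sup>2 + (-1) * ((x + (- x0)) \<bullet> (x + (- x0))))" for x
  show "smooth_on UNIV f" unfolding f_def
    by (intro smooth_on_compose_real[OF _ flat_exp_smooth] smooth_on_add smooth_on_const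
        smooth_on_bilinear[OF _ bounded_bilinear_inner] smooth_on_bilinear[OF _ bounded_bilinear_mult]
        smooth_on_linear bounded_linear_ident) auto
  show "f x \<ge> 0" for x by (simp add: f_def flat_exp_def)
  show "f x0 > 0" using assms by (simp add: f_def flat_exp_def)
  show "f x = 0" if "x \<notin> cball x0 r" for x
  proof -
    have "r \<le> norm (x - x0)" using that by (simp add: dist_norm norm_minus_commute)
    then have "r\<^sup>2 \<le> (norm (x - x0))\<^sup>2" using assms by (simp add: power_mono)
    then show ?thesis by (simp add: f_def flat_exp_def power2_norm_eq_inner)
  qed
qed

section \<open>Compactly supported integrals and the derivative of the determinant\<close>

lemma integral_cbox_supported:
  fixes w :: "'a::euclidean_space \<Rightarrow> 'b::banach"
  assumes "\<And>x. x \<notin> K \<Longrightarrow> w x = 0" "K \<subseteq> cbox a b"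
  shows "integral (cbox a b) w = integral UNIV w"
proof -
  have "(\<lambda>x. if x \<in> cbox a b then w x else 0) = w"
    using assms by (auto simp: fun_eq_iff)
  then show ?thesis using integral_restrict_UNIV[of "cbox a b" w] by simp
qed

text \<open>
  The integral of \<open>w\<close> does not change when \<open>w\<close> is translated along \<open>v\<close>; differentiating this
  constant under the integral sign gives the claim.
\<close>

lemma integral_derivative_compact_support_UNIV:
  fixes w :: "'a::euclidean_space \<Rightarrow> real"
  assumes deriv: "\<And>x. (w has_derivative w' x) (at x)"
    and cont: "continuous_on UNIV (\<lambda>x. w' x v)"
    and K: "compact K" "\<And>x. x \<notin> K \<Longrightarrow> w x = 0"
    and K': "\<And>x. x \<notin> K \<Longrightarrow> w' x v = 0"
  shows "integral UNIV (\<lambda>x. w' x v) = 0"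
proof -
  \<comment> \<open>One box that contains all translates of the support by at most one step along \<open>v\<close>.\<close>
  define L where "L = (\<lambda>(x, h). x - h *\<^sub>R v) ` (K \<times> {-1..1::real})"
  have "compact L" unfolding L_def
    by (intro compact_continuous_image compact_Times K compact_Icc)
      (auto intro!: continuous_intros simp: split_beta)
  then obtain c where c: "L \<subseteq> cbox (-c) c"
    using bounded_subset_cbox_symmetric compact_imp_bounded by metis
  have KL: "x - h *\<^sub>R v \<in> L" if "x \<in> K" "\<bar>h\<bar> \<le> 1" for x h
    using that unfolding L_def by force
  have KB: "K \<subseteq> cbox (-c) c" using KL[of _ 0] c by auto
  have const: "integral (cbox (-c) c) (\<lambda>x. w (h *\<^sub>R v + x)) = integral UNIV w" if "\<bar>h\<bar> \<le> 1" for h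
  proof -
    have "K \<subseteq> cbox (- c + h *\<^sub>R v) (c + h *\<^sub>R v)"
    proof
      fix x assume "x \<in> K"
      then have "x - h *\<^sub>R v \<in> cbox (-c) c" using KL c that by auto
      then show "x \<in> cbox (- c + h *\<^sub>R v) (c + h *\<^sub>R v)"
        by (auto simp: mem_box algebra_simps)
    qed
    then have "integral (cbox (- c + h *\<^sub>R v) (c + h *\<^sub>R v)) w = integral UNIV w"
      by (intro integral_cbox_supported) (use K in auto)
    then show ?thesis using integral_shift_cbox_plus[of "-c" c w "h *\<^sub>R v"] by (simp add: o_def)
  qed
  have contw: "continuous_on UNIV w"
    using deriv by (meson continuous_at_imp_continuous_on has_derivative_continuous)
  have "((\<lambda>h. integral (cbox (-c) c) (\<lambda>x. w (h *\<^sub>R v + x))) has_real_derivative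
          integral (cbox (-c) c) (\<lambda>x. w' (0 *\<^sub>R v + x) v)) (at 0 within UNIV)"
  proof (rule leibniz_rule_field_derivative)
    fix h x
    have "((\<lambda>h. h *\<^sub>R v + x) has_derivative (\<lambda>r. r *\<^sub>R v)) (at h)"
      by (auto intro!: derivative_eq_intros)
    then have "((\<lambda>h. w (h *\<^sub>R v + x)) has_derivative (\<lambda>r. w' (h *\<^sub>R v + x) (r *\<^sub>R v))) (at h)"
      by (rule has_derivative_compose) (rule deriv)
    moreover have "w' (h *\<^sub>R v + x) (r *\<^sub>R v) = w' (h *\<^sub>R v + x) v * r" for r
      using linear_cmul[OF has_derivative_linear[OF deriv]] by simp
    ultimately show "((\<lambda>h. w (h *\<^sub>R v + x)) has_real_derivative w' (h *\<^sub>R v + x) v) (at h within UNIV)"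
      by (simp add: has_field_derivative_def)
  next
    fix h :: real
    show "(\<lambda>x. w (h *\<^sub>R v + x)) integrable_on cbox (-c) c"
      by (intro integrable_continuous continuous_on_compose2[OF contw]) (auto intro: continuous_intros)
  next
    show "continuous_on (UNIV \<times> cbox (-c) c) (\<lambda>(h, x). w' (h *\<^sub>R v + x) v)"
      unfolding split_beta
      by (intro continuous_on_compose2[OF cont]) (auto intro!: continuous_intros)
  qed auto
  then have "((\<lambda>h. integral (cbox (-c) c) (\<lambda>x. w (h *\<^sub>R v + x))) has_real_derivative
          integral UNIV (\<lambda>x. w' x v)) (at 0)"
    using integral_cbox_supported[of K "\<lambda>x. w' x v", OF K' KB] by simp
  moreover have "((\<lambda>h. integral (cbox (-c) c) (\<lambda>x. w (h *\<^sub>R v + x))) has_real_derivative 0) (at 0)"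
    by (rule has_field_derivative_transform_within_open[OF DERIV_const, where S = "{-1<..<1}"])
      (use const in auto)
  ultimately show ?thesis using DERIV_unique by blast
qed

text \<open>
  Extension by zero reduces this to the whole space: the extension is \<open>C\<^sup>1\<close> because \<open>\<Omega>\<close> and the
  complement of the support form an open cover.
\<close>

lemma integral_derivative_compact_support:
  fixes u :: "'a::euclidean_space \<Rightarrow> real"
  assumes "open \<Omega>" and u: "Ck_on 1 \<Omega> u" and K: "compact K" "K \<subseteq> \<Omega>" "\<And>x. x \<in> \<Omega> - K \<Longrightarrow> u x = 0"
    and B: "K \<subseteq> cbox a b" "cbox a b \<subseteq> \<Omega>"
  shows "integral (cbox a b) (\<lambda>x. frechet_derivative u (at x) v) = 0"
proof -
  define w where "w x = (if x \<in> \<Omega> then u x else 0)" for x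
  define w' where "w' x = (if x \<in> \<Omega> then frechet_derivative u (at x) else (\<lambda>_. 0))" for x
  have "open (- K)" using K(1) by (simp add: compact_imp_closed open_Compl)
  have du: "(u has_derivative frechet_derivative u (at x)) (at x)" if "x \<in> \<Omega>" for x
    using u that by (intro has_frechet_derivative) simp
  have w'0: "w' x = (\<lambda>_. 0)" if "x \<notin> K" for x
  proof (cases "x \<in> \<Omega>")
    case True
    have "((\<lambda>x. 0) has_derivative frechet_derivative u (at x)) (at x)"
      by (rule has_derivative_transform_within_open[OF du, where s = "\<Omega> - K"])
        (use True that K \<open>open \<Omega>\<close> in \<open>auto simp: compact_imp_closed open_Diff\<close>)
    then have "frechet_derivative u (at x) = (\<lambda>_. 0)"
      using has_derivative_unique has_derivative_const by blast
    then show ?thesis using True by (simp add: w'_def)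
  qed (simp add: w'_def)
  have w0: "w x = 0" if "x \<notin> K" for x using that K by (auto simp: w_def)
  have "integral UNIV (\<lambda>x. w' x v) = 0"
  proof (rule integral_derivative_compact_support_UNIV[where w = w and K = K])
    fix x
    show "(w has_derivative w' x) (at x)"
    proof (cases "x \<in> K")
      case True
      then have "x \<in> \<Omega>" using K by auto
      have "(w has_derivative frechet_derivative u (at x)) (at x)"
        by (rule has_derivative_transform_within_open[OF du[OF \<open>x \<in> \<Omega>\<close>] \<open>open \<Omega>\<close> \<open>x \<in> \<Omega>\<close>])
          (simp add: w_def)
      then show ?thesis using \<open>x \<in> \<Omega>\<close> by (simp add: w'_def)
    next
      case False
      have "(w has_derivative (\<lambda>_. 0)) (at x)"
        by (rule has_derivative_transform_within_open[OF has_derivative_const \<open>open (-K)\<close>])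
          (use False w0 in auto)
      then show ?thesis using False w'0 by simp
    qed
  next
    have "continuous_on \<Omega> (\<lambda>x. w' x v)"
      using u by (simp add: w'_def cong: continuous_on_cong)
    moreover have "continuous_on (-K) (\<lambda>x. w' x v)"
      using continuous_on_cong[of "-K" "-K" "\<lambda>x. w' x v" "\<lambda>_. 0"] w'0 by simp
    ultimately have "continuous_on (\<Omega> \<union> -K) (\<lambda>x. w' x v)"
      using \<open>open \<Omega>\<close> \<open>open (-K)\<close> continuous_on_open_Un by blast
    moreover have "\<Omega> \<union> -K = UNIV" using K by auto
    ultimately show "continuous_on UNIV (\<lambda>x. w' x v)" by simp
  qed (use K w0 w'0 in auto)
  then have "integral (cbox a b) (\<lambda>x. w' x v) = 0"
    using integral_cbox_supported[of K "\<lambda>x. w' x v"] w'0 B by simp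
  moreover have "integral (cbox a b) (\<lambda>x. w' x v) = integral (cbox a b) (\<lambda>x. frechet_derivative u (at x) v)"
    by (rule integral_cong) (use B in \<open>auto simp: w'_def\<close>)
  ultimately show ?thesis by simp
qed

lemma has_vector_derivative_slice:
  fixes f :: "real \<times> 'a::real_normed_vector \<Rightarrow> 'b::real_normed_vector"
  assumes "f differentiable (at (t, x))"
  shows "((\<lambda>t. f (t, x)) has_vector_derivative frechet_derivative f (at (t, x)) (1, 0)) (at t)"
proof -
  note df = has_frechet_derivative[OF assms]
  have "((\<lambda>t. (t, x)) has_derivative (\<lambda>r. (r, 0))) (at t)"
    by (auto intro!: derivative_eq_intros)
  from has_derivative_compose[OF this df]
  have "((\<lambda>t. f (t, x)) has_derivative (\<lambda>r. frechet_derivative f (at (t, x)) (r, 0))) (at t)" .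
  moreover have "(\<lambda>r. frechet_derivative f (at (t, x)) (r, 0)) = (\<lambda>r. r *\<^sub>R frechet_derivative f (at (t, x)) (1, 0))"
  proof
    fix r
    show "frechet_derivative f (at (t, x)) (r, 0) = r *\<^sub>R frechet_derivative f (at (t, x)) (1, 0)"
      using linear_cmul[OF has_derivative_linear[OF df], of r "(1, 0)"] by simp
  qed
  ultimately show ?thesis by (simp only: has_vector_derivative_def)
qed

lemma frechet_derivative_slice:
  assumes "f differentiable (at (t, x))"
  shows "frechet_derivative (\<lambda>x. f (t, x)) (at x) v = frechet_derivative f (at (t, x)) (0, v)"
proof -
  have "((\<lambda>x. (t, x)) has_derivative (\<lambda>v. (0, v))) (at x)"
    by (auto intro!: derivative_eq_intros)
  from has_derivative_compose[OF this has_frechet_derivative[OF assms]]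
  have "((\<lambda>x. f (t, x)) has_derivative (\<lambda>v. frechet_derivative f (at (t, x)) (0, v))) (at x)" .
  from frechet_derivative_at[OF this, symmetric] show ?thesis by (simp only:)
qed

text \<open>
  Differentiation under the integral sign in the form used for variations: time is the first
  component of a function on space-time, and the time derivative is its derivative along \<open>(1, 0)\<close>.
\<close>

lemma leibniz_rule_smooth:
  fixes f :: "real \<times> 'a::euclidean_space \<Rightarrow> real"
  assumes "open U" and f: "Ck_on 1 U f" and \<delta>: "\<delta> > 0" "{-\<delta>..\<delta>} \<times> cbox a b \<subseteq> U"
  shows "((\<lambda>t. integral (cbox a b) (\<lambda>x. f (t, x))) has_real_derivative
    integral (cbox a b) (\<lambda>x. frechet_derivative f (at (0, x)) (1, 0))) (at 0)"
proof -
  have contf: "continuous_on U f"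
    using Ck_on_SucD[of 0 U f] f unfolding One_nat_def Ck_on.simps(1) by blast
  have "((\<lambda>t. integral (cbox a b) (\<lambda>x. f (t, x))) has_real_derivative
    integral (cbox a b) (\<lambda>x. frechet_derivative f (at (0, x)) (1, 0))) (at 0 within {-\<delta>..\<delta>})"
  proof (rule leibniz_rule_field_derivative)
    fix t x assume tx: "t \<in> {-\<delta>..\<delta>}" "x \<in> cbox a b"
    then have "(t, x) \<in> U" using \<delta> by auto
    then have "f differentiable (at (t, x))" using f by simp
    then have "((\<lambda>t. f (t, x)) has_real_derivative frechet_derivative f (at (t, x)) (1, 0)) (at t)"
      by (simp add: has_real_derivative_iff_has_vector_derivative has_vector_derivative_slice)
    then show "((\<lambda>t. f (t, x)) has_real_derivative frechet_derivative f (at (t, x)) (1, 0))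
        (at t within {-\<delta>..\<delta>})"
      by (rule has_field_derivative_at_within)
  next
    fix t assume "t \<in> {-\<delta>..\<delta>}"
    then show "(\<lambda>x. f (t, x)) integrable_on cbox a b"
      using \<delta>
      by (intro integrable_continuous continuous_on_compose2[OF contf]) (auto intro!: continuous_intros)
  next
    have "continuous_on U (\<lambda>z. frechet_derivative f (at z) (1, 0))" using f by simp
    then show "continuous_on ({-\<delta>..\<delta>} \<times> cbox a b) (\<lambda>(t, x). frechet_derivative f (at (t, x)) (1, 0))"
      using continuous_on_subset[OF _ \<delta>(2)] by (simp add: split_beta)
  qed (use \<delta> in auto)
  moreover have "at 0 within {-\<delta>..\<delta>} = at (0::real)"
    using \<delta> by (intro at_within_interior) auto
  ultimately show ?thesis by simp
qed

text \<open>
  Jacobi's formula at the identity. A permutation other than the identity moves two indices, so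
  each term of the derivative of its product keeps an off-diagonal entry, which is zero.
\<close>

lemma DERIV_det_mat_1:
  fixes A :: "real \<Rightarrow> real^'n^'n"
  assumes "\<And>i j. ((\<lambda>t. A t $ i $ j) has_real_derivative A' i j) (at x)" "A x = mat 1"
  shows "((\<lambda>t. det (A t)) has_real_derivative (\<Sum>i\<in>UNIV. A' i i)) (at x)"
proof -
  let ?c = "\<lambda>p i. \<Prod>j\<in>UNIV-{i}. A x $ j $ p j"
  have "((\<lambda>t. det (A t)) has_real_derivative
      (\<Sum>p | p permutes (UNIV::'n set). of_int (sign p) * (\<Sum>i\<in>UNIV. A' i (p i) * ?c p i))) (at x)"
    unfolding det_def
    by (intro DERIV_sum DERIV_cmult has_field_derivative_prod assms(1))
  moreover have "(\<Sum>i\<in>UNIV. A' i (p i) * ?c p i) = 0" if p: "p permutes UNIV" "p \<noteq> id" for p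
  proof -
    obtain k where k: "p k \<noteq> k" using p(2) by (auto simp: fun_eq_iff)
    have pk: "p (p k) \<noteq> p k" using k permutes_inj[OF p(1)] by (simp add: inj_eq)
    have "?c p i = 0" for i
    proof -
      define j where "j = (if i = k then p k else k)"
      have "j \<in> UNIV - {i}" "A x $ j $ p j = 0"
        using k pk assms(2) by (auto simp: j_def mat_def)
      then show ?thesis by (intro prod_zero) auto
    qed
    then show ?thesis by (simp only: mult_zero_right sum.neutral_const)
  qed
  then have "(\<Sum>p | p permutes (UNIV::'n set). of_int (sign p) * (\<Sum>i\<in>UNIV. A' i (p i) * ?c p i))
      = (\<Sum>p\<in>{id}. of_int (sign p) * (\<Sum>i\<in>UNIV. A' i (p i) * ?c p i))"
    by (intro sum.mono_neutral_right) (auto simp: permutes_id)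
  moreover have "?c id i = 1" for i using assms(2) by (simp add: mat_def)
  ultimately show ?thesis by (simp add: sign_id)
qed

section \<open>Plane curves parametrized by arclength\<close>

lemma smooth_on_vector_derivative:
  fixes f :: "real \<Rightarrow> 'b::real_normed_vector"
  assumes "open S" "smooth_on S f"
  shows "smooth_on S (\<lambda>s. vector_derivative f (at s))"
proof -
  have "frechet_derivative f (at s) 1 = vector_derivative f (at s)" if "s \<in> S" for s
    using frechet_derivative_eq_vector_derivative[OF smooth_on_differentiable[OF assms(2) that]] by simp
  then show ?thesis
    by (intro smooth_on_cong[OF assms(1), THEN iffD1, OF _ smooth_on_frechet_derivative[OF assms(2), of 1]])
qed

abbreviation velocity :: "(real \<Rightarrow> complex) \<Rightarrow> real \<Rightarrow> complex" where
  "velocity \<alpha> s \<equiv> vector_derivative \<alpha> (at s)"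

lemma complex_frame_expansion:
  assumes "norm z = 1"
  shows "w = (w \<bullet> z) *\<^sub>R z + (w \<bullet> (\<i> * z)) *\<^sub>R (\<i> * z)"
proof -
  have z: "Re z * Re z + Im z * Im z = 1"
    using assms by (simp add: cmod_def power2_eq_square)
  have "Re w = Re w * (Re z * Re z + Im z * Im z)" "Im w = Im w * (Re z * Re z + Im z * Im z)"
    by (simp_all add: z)
  then show ?thesis
    by (auto simp: complex_eq_iff inner_complex_def algebra_simps)
qed

lemma inner_i_self: "z \<bullet> (\<i> * z) = 0" "(\<i> * z) \<bullet> z = 0" for z :: complex
  by (simp_all add: inner_complex_def)

lemma inner_i_times_i_times: "(\<i> * z) \<bullet> (\<i> * w) = z \<bullet> w" for z w :: complex
  by (simp add: inner_complex_def)

lemma inner_i_left: "(\<i> * z) \<bullet> w = - (z \<bullet> (\<i> * w))" for z w :: complex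
  by (simp add: inner_complex_def)

context
  fixes I :: "real set" and \<alpha> :: "real \<Rightarrow> complex"
  assumes curve: "arclength_curve I \<alpha>"
begin

lemma curve_open: "open I" and curve_convex: "convex I" and curve_nonempty: "I \<noteq> {}"
  and curve_smooth: "smooth_on I \<alpha>" and norm_velocity: "s \<in> I \<Longrightarrow> norm (velocity \<alpha> s) = 1"
  using curve by (auto simp: arclength_curve_def is_interval_convex)

lemma inner_velocity: "s \<in> I \<Longrightarrow> velocity \<alpha> s \<bullet> velocity \<alpha> s = 1"
  using norm_velocity by (metis norm_eq_1)

lemma velocity_smooth: "smooth_on I (velocity \<alpha>)"
  using smooth_on_vector_derivative curve_open curve_smooth by blast

lemma curve_deriv: "s \<in> I \<Longrightarrow> (\<alpha> has_vector_derivative velocity \<alpha> s) (at s)"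
  using smooth_on_differentiable[OF curve_smooth] vector_derivative_works by blast

lemma curvature_smooth: "smooth_on I (signed_curvature \<alpha>)"
  unfolding signed_curvature_def
  by (intro smooth_on_bilinear[OF curve_open bounded_bilinear_inner]
      smooth_on_vector_derivative velocity_smooth curve_open
      smooth_on_linear_compose[OF curve_open bounded_linear_mult_right])

lemma curvature_deriv:
  "s \<in> I \<Longrightarrow> (signed_curvature \<alpha> has_real_derivative deriv (signed_curvature \<alpha>) s) (at s)"
  using smooth_on_differentiable[OF curvature_smooth]
  by (simp add: DERIV_deriv_iff_real_differentiable)

text \<open>
  Differentiating \<open>|\<alpha>'|\<^sup>2 = 1\<close> shows that the acceleration is orthogonal to the velocity, and in the
  plane that leaves only the direction \<open>\<i> \<alpha>'\<close>.
\<close>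

lemma frenet:
  assumes "s \<in> I"
  shows "(velocity \<alpha> has_vector_derivative signed_curvature \<alpha> s *\<^sub>R (\<i> * velocity \<alpha> s)) (at s)"
proof -
  let ?a = "vector_derivative (velocity \<alpha>) (at s)"
  have a: "(velocity \<alpha> has_vector_derivative ?a) (at s)"
    using smooth_on_differentiable[OF velocity_smooth assms] vector_derivative_works by blast
  have "((\<lambda>u. velocity \<alpha> u \<bullet> velocity \<alpha> u) has_real_derivative
      velocity \<alpha> s \<bullet> ?a + ?a \<bullet> velocity \<alpha> s) (at s)"
    using bounded_bilinear.has_vector_derivative[OF bounded_bilinear_inner a a]
    by (simp add: has_real_derivative_iff_has_vector_derivative)
  moreover have "((\<lambda>u. velocity \<alpha> u \<bullet> velocity \<alpha> u) has_real_derivative 0) (at s)"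
    by (rule has_field_derivative_transform_within_open[OF DERIV_const curve_open assms])
      (simp add: inner_velocity)
  ultimately have "?a \<bullet> velocity \<alpha> s = 0"
    using DERIV_unique by (fastforce simp: inner_commute)
  then have "?a = signed_curvature \<alpha> s *\<^sub>R (\<i> * velocity \<alpha> s)"
    using complex_frame_expansion[OF norm_velocity[OF assms], of ?a]
    by (simp add: signed_curvature_def)
  then show ?thesis using a by simp
qed

text \<open>
  On a circle with centre \<open>c\<close> the radius vector is normal, so it is \<open>g \<i> \<alpha>'\<close> with
  \<open>g = (\<alpha> - c) \<bullet> \<i> \<alpha>'\<close>. The Frenet equation makes \<open>g\<close> constant, and differentiating
  \<open>(\<alpha> - c) \<bullet> \<alpha>' = 0\<close> once more gives \<open>\<kappa> g = -1\<close>.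
\<close>

lemma circle_imp_constant_curvature:
  assumes "is_circle_on I \<alpha>"
  shows "\<exists>k. \<forall>s\<in>I. signed_curvature \<alpha> s = k"
proof -
  obtain c r where r: "r > 0" and "\<alpha> ` I \<subseteq> sphere c r"
    using assms by (auto simp: is_circle_on_def)
  then have dist: "(\<alpha> s - c) \<bullet> (\<alpha> s - c) = r\<^sup>2" if "s \<in> I" for s
    using that by (auto simp: dist_norm norm_minus_commute power2_norm_eq_inner[symmetric] subset_iff)
  define g where "g s = (\<alpha> s - c) \<bullet> (\<i> * velocity \<alpha> s)" for s
  have da: "((\<lambda>s. \<alpha> s - c) has_vector_derivative velocity \<alpha> s) (at s)" if "s \<in> I" for s
    using curve_deriv[OF that] has_vector_derivative_diff_const by blast
  have radial: "(\<alpha> s - c) \<bullet> velocity \<alpha> s = 0" if "s \<in> I" for s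
  proof -
    have "((\<lambda>s. (\<alpha> s - c) \<bullet> (\<alpha> s - c)) has_real_derivative 0) (at s)"
      by (rule has_field_derivative_transform_within_open[OF DERIV_const curve_open that])
        (simp add: dist)
    moreover have "((\<lambda>s. (\<alpha> s - c) \<bullet> (\<alpha> s - c)) has_real_derivative
        (\<alpha> s - c) \<bullet> velocity \<alpha> s + velocity \<alpha> s \<bullet> (\<alpha> s - c)) (at s)"
      using bounded_bilinear.has_vector_derivative[OF bounded_bilinear_inner da[OF that] da[OF that]]
      by (simp add: has_real_derivative_iff_has_vector_derivative)
    ultimately show ?thesis using DERIV_unique by (fastforce simp: inner_commute)
  qed
  have kg: "signed_curvature \<alpha> s * g s = -1" if "s \<in> I" for s
  proof -
    have "((\<lambda>s. (\<alpha> s - c) \<bullet> velocity \<alpha> s) has_real_derivative 0) (at s)"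
      by (rule has_field_derivative_transform_within_open[OF DERIV_const curve_open that])
        (simp add: radial)
    moreover have "((\<lambda>s. (\<alpha> s - c) \<bullet> velocity \<alpha> s) has_real_derivative
        (\<alpha> s - c) \<bullet> (signed_curvature \<alpha> s *\<^sub>R (\<i> * velocity \<alpha> s)) + velocity \<alpha> s \<bullet> velocity \<alpha> s) (at s)"
      using bounded_bilinear.has_vector_derivative[OF bounded_bilinear_inner da[OF that] frenet[OF that]]
      by (simp add: has_real_derivative_iff_has_vector_derivative)
    ultimately show ?thesis
      using DERIV_unique inner_velocity[OF that] by (fastforce simp: g_def)
  qed
  have "(g has_vector_derivative 0) (at s within I)" if "s \<in> I" for s
  proof -
    have "((\<lambda>s. \<i> * velocity \<alpha> s) has_vector_derivative \<i> * (signed_curvature \<alpha> s *\<^sub>R (\<i> * velocity \<alpha> s))) (at s)"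
      by (rule bounded_linear.has_vector_derivative[OF bounded_linear_mult_right frenet[OF that]])
    from bounded_bilinear.has_vector_derivative[OF bounded_bilinear_inner da[OF that] this]
    have "(g has_vector_derivative 0) (at s)"
      using radial[OF that] by (simp add: g_def[abs_def] inner_i_self)
    then show ?thesis by (rule has_vector_derivative_at_within)
  qed
  then obtain d where "\<And>s. s \<in> I \<Longrightarrow> g s = d"
    using has_vector_derivative_zero_constant[OF curve_convex, of g] by blast
  then have "\<forall>s\<in>I. signed_curvature \<alpha> s = - 1 / d"
    using kg by (metis eq_divide_imp mult_zero_right zero_neq_neg_one)
  then show ?thesis by blast
qed

lemma line_imp_curvature_zero:
  assumes "is_line_on I \<alpha>"
  shows "\<forall>s\<in>I. signed_curvature \<alpha> s = 0"
proof
  fix s assume s: "s \<in> I"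
  obtain p v where v: "v \<noteq> 0" and line: "\<alpha> ` I \<subseteq> range (\<lambda>t. p + t *\<^sub>R v)"
    using assms by (auto simp: is_line_on_def)
  have on: "(\<alpha> u - p) \<bullet> (\<i> * v) = 0" if "u \<in> I" for u
    using line that by (auto simp: inner_i_self image_iff subset_iff)
  have der0: "w \<bullet> (\<i> * v) = 0" if "(f has_vector_derivative w) (at u)" "u \<in> I"
    "\<And>u. u \<in> I \<Longrightarrow> f u \<bullet> (\<i> * v) = 0" for f u and w :: complex
  proof -
    have "((\<lambda>u. f u \<bullet> (\<i> * v)) has_real_derivative w \<bullet> (\<i> * v)) (at u)"
      using bounded_linear.has_vector_derivative[OF bounded_linear_inner_left that(1)]
      by (simp add: has_real_derivative_iff_has_vector_derivative)
    moreover have "((\<lambda>u. f u \<bullet> (\<i> * v)) has_real_derivative 0) (at u)"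
      by (rule has_field_derivative_transform_within_open[OF DERIV_const curve_open that(2)])
        (simp add: that(3))
    ultimately show ?thesis using DERIV_unique by blast
  qed
  have T: "velocity \<alpha> u \<bullet> (\<i> * v) = 0" if "u \<in> I" for u
  proof -
    have "((\<lambda>u. \<alpha> u - p) has_vector_derivative velocity \<alpha> u) (at u)"
      using curve_deriv[OF that] has_vector_derivative_diff_const by blast
    then show ?thesis using that on by (rule der0)
  qed
  have "(signed_curvature \<alpha> s *\<^sub>R (\<i> * velocity \<alpha> s)) \<bullet> (\<i> * v) = 0"
    by (rule der0[OF frenet[OF s] s T])
  moreover have "velocity \<alpha> s \<bullet> v \<noteq> 0"
  proof
    assume "velocity \<alpha> s \<bullet> v = 0"
    then have "v = 0"
      using complex_frame_expansion[OF norm_velocity[OF s], of v] T[OF s]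
      by (simp add: inner_commute inner_i_left)
    then show False using v by simp
  qed
  ultimately show "signed_curvature \<alpha> s = 0" by (simp add: inner_i_times_i_times)
qed

lemma curvature_zero_imp_line:
  assumes "\<forall>s\<in>I. signed_curvature \<alpha> s = 0"
  shows "is_line_on I \<alpha>"
proof -
  obtain s0 where s0: "s0 \<in> I" using curve_nonempty by auto
  have "(velocity \<alpha> has_vector_derivative 0) (at s within I)" if "s \<in> I" for s
    using frenet[OF that] assms that has_vector_derivative_at_within by fastforce
  then obtain v where v: "\<And>s. s \<in> I \<Longrightarrow> velocity \<alpha> s = v"
    using has_vector_derivative_zero_constant[OF curve_convex, of "velocity \<alpha>"] by blast
  have "((\<lambda>s. \<alpha> s - s *\<^sub>R v) has_vector_derivative 0) (at s within I)" if "s \<in> I" for s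
  proof -
    have "((\<lambda>s. \<alpha> s - s *\<^sub>R v) has_vector_derivative velocity \<alpha> s - v) (at s)"
      by (auto intro!: derivative_eq_intros curve_deriv that)
    then show ?thesis using v that has_vector_derivative_at_within by fastforce
  qed
  then obtain p where p: "\<And>s. s \<in> I \<Longrightarrow> \<alpha> s - s *\<^sub>R v = p"
    using has_vector_derivative_zero_constant[OF curve_convex, of "\<lambda>s. \<alpha> s - s *\<^sub>R v"] by blast
  have "\<alpha> ` I \<subseteq> range (\<lambda>t. p + t *\<^sub>R v)"
  proof
    fix z assume "z \<in> \<alpha> ` I"
    then obtain s where "s \<in> I" "z = \<alpha> s" by auto
    then have "z = p + s *\<^sub>R v" using p[of s] by (simp add: algebra_simps)
    then show "z \<in> range (\<lambda>t. p + t *\<^sub>R v)" by blast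
  qed
  moreover have "v \<noteq> 0" using norm_velocity[OF s0] v[OF s0] by auto
  ultimately show ?thesis by (auto simp: is_line_on_def)
qed

text \<open>The centre is the centre of curvature \<open>\<alpha> + \<i> \<alpha>' / k\<close>, whose derivative vanishes.\<close>

lemma constant_curvature_imp_circle:
  assumes k: "\<forall>s\<in>I. signed_curvature \<alpha> s = k" "k \<noteq> 0"
  shows "is_circle_on I \<alpha>"
proof -
  have "((\<lambda>s. \<alpha> s + (1 / k) *\<^sub>R (\<i> * velocity \<alpha> s)) has_vector_derivative 0) (at s within I)" if "s \<in> I" for s
  proof -
    have "((\<lambda>s. \<alpha> s + (1 / k) *\<^sub>R (\<i> * velocity \<alpha> s)) has_vector_derivative
        velocity \<alpha> s + (1 / k) *\<^sub>R (\<i> * (signed_curvature \<alpha> s *\<^sub>R (\<i> * velocity \<alpha> s)))) (at s)"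
      by (intro has_vector_derivative_add curve_deriv[OF that]
          bounded_linear.has_vector_derivative[OF bounded_linear_scaleR_right]
          bounded_linear.has_vector_derivative[OF bounded_linear_mult_right] frenet[OF that])
    moreover have "velocity \<alpha> s + (1 / k) *\<^sub>R (\<i> * (signed_curvature \<alpha> s *\<^sub>R (\<i> * velocity \<alpha> s))) = 0"
      using k that by (simp add: complex_eq_iff)
    ultimately show ?thesis using has_vector_derivative_at_within by fastforce
  qed
  then obtain c where c: "\<And>s. s \<in> I \<Longrightarrow> \<alpha> s + (1 / k) *\<^sub>R (\<i> * velocity \<alpha> s) = c"
    using has_vector_derivative_zero_constant[OF curve_convex,
        of "\<lambda>s. \<alpha> s + (1 / k) *\<^sub>R (\<i> * velocity \<alpha> s)"] by blast
  have "dist c (\<alpha> s) = \<bar>1 / k\<bar>" if "s \<in> I" for s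
    using c[OF that] norm_velocity[OF that] by (auto simp: dist_norm norm_mult)
  then show ?thesis using k(2) by (auto simp: is_circle_on_def intro!: exI[of _ c] exI[of _ "\<bar>1 / k\<bar>"])
qed

lemma circle_or_line_iff:
  "is_circle_on I \<alpha> \<or> is_line_on I \<alpha> \<longleftrightarrow> (\<exists>k. \<forall>s\<in>I. signed_curvature \<alpha> s = k)"
  using circle_imp_constant_curvature line_imp_curvature_zero
    curvature_zero_imp_line constant_curvature_imp_circle by metis

text \<open>
  Circles, lines and Cornu spirals together are the curves of affine curvature. The three cases
  become a single condition on the derivative of the curvature, where \<open>l\<close> is the slope: it is
  \<open>0\<close> for circles and lines and the parameter for a spiral.
\<close>

lemma affine_curvature_iff:
  "(is_circle_on I \<alpha> \<or> is_line_on I \<alpha>) \<and> l = 0 \<or> is_cornu_spiral_on l I \<alpha> \<longleftrightarrow>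
    (\<forall>s\<in>I. deriv (signed_curvature \<alpha>) s = l)"
proof -
  have "(\<forall>s\<in>I. deriv (signed_curvature \<alpha>) s = l) \<longleftrightarrow> (\<exists>m. \<forall>s\<in>I. signed_curvature \<alpha> s = l * s + m)"
  proof
    assume l: "\<forall>s\<in>I. deriv (signed_curvature \<alpha>) s = l"
    have "((\<lambda>s. signed_curvature \<alpha> s - l * s) has_vector_derivative 0) (at s within I)" if "s \<in> I" for s
    proof -
      have "((\<lambda>s. signed_curvature \<alpha> s - l * s) has_real_derivative 0) (at s)"
        using curvature_deriv[OF that] l that by (auto intro!: derivative_eq_intros)
      then show ?thesis
        by (simp add: has_real_derivative_iff_has_vector_derivative has_vector_derivative_at_within)
    qed
    then obtain m where "\<And>s. s \<in> I \<Longrightarrow> signed_curvature \<alpha> s - l * s = m"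
      using has_vector_derivative_zero_constant[OF curve_convex,
          of "\<lambda>s. signed_curvature \<alpha> s - l * s"] by blast
    then show "\<exists>m. \<forall>s\<in>I. signed_curvature \<alpha> s = l * s + m" by (metis add.commute diff_add_cancel)
  next
    assume "\<exists>m. \<forall>s\<in>I. signed_curvature \<alpha> s = l * s + m"
    then obtain m where m: "\<And>s. s \<in> I \<Longrightarrow> signed_curvature \<alpha> s = l * s + m" by blast
    show "\<forall>s\<in>I. deriv (signed_curvature \<alpha>) s = l"
    proof
      fix s assume s: "s \<in> I"
      have "(signed_curvature \<alpha> has_real_derivative l) (at s)"
        by (rule has_field_derivative_transform_within_open[of "\<lambda>s. l * s + m", OF _ curve_open s])
          (auto simp: m intro!: derivative_eq_intros)
      then show "deriv (signed_curvature \<alpha>) s = l" by (rule DERIV_imp_deriv)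
    qed
  qed
  then show ?thesis by (auto simp: circle_or_line_iff is_cornu_spiral_on_def)
qed

end

section \<open>Geometry of a product of plane curves\<close>

lemma bounded_linear_axis: "bounded_linear (\<lambda>x::'a::real_normed_vector. axis j x :: 'a^'n)"
proof (rule bounded_linear_intro[where K = 1])
  show "norm (axis j x :: 'a^'n) \<le> norm x * 1" for x :: 'a
  proof -
    have "norm (axis j x :: 'a^'n) \<le> (\<Sum>i\<in>UNIV. norm ((axis j x :: 'a^'n) $ i))"
      unfolding norm_vec_def by (rule L2_set_le_sum) simp
    also have "\<dots> = norm x" by (simp add: axis_def if_distrib cong: if_cong)
    finally show ?thesis by simp
  qed
qed (auto simp: axis_def vec_eq_iff)

lemma vec_lambda_eq_sum_axis: "(\<chi> j. f j) = (\<Sum>j\<in>UNIV. axis j (f j) :: 'a::real_normed_vector^'n)"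
  by (simp add: vec_eq_iff axis_def if_distrib cong: if_cong)

lemma has_derivative_coordinatewise:
  fixes g :: "'n::finite \<Rightarrow> real \<Rightarrow> 'a::real_normed_vector"
  assumes "\<And>j. (g j has_vector_derivative g' j) (at (s $ j))"
  shows "((\<lambda>s. \<chi> j. g j (s $ j)) has_derivative (\<lambda>v. \<chi> j. v $ j *\<^sub>R g' j)) (at s)"
  unfolding vec_lambda_eq_sum_axis
proof (intro has_derivative_sum bounded_linear.has_derivative[OF bounded_linear_axis])
  fix j
  have "((\<lambda>s::real^'n. s $ j) has_derivative (\<lambda>v. v $ j)) (at s)"
    by (rule bounded_linear_imp_has_derivative[OF bounded_linear_vec_nth])
  from has_derivative_compose[OF this assms[of j, unfolded has_vector_derivative_def]]
  show "((\<lambda>s. g j (s $ j)) has_derivative (\<lambda>v. v $ j *\<^sub>R g' j)) (at s)" .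
qed

lemma smooth_on_coordinatewise:
  fixes g :: "'n::finite \<Rightarrow> real \<Rightarrow> 'a::real_normed_vector"
  assumes "open S" "\<And>j. smooth_on (T j) (g j)" "\<And>s j. s \<in> S \<Longrightarrow> s $ j \<in> T j"
  shows "smooth_on S (\<lambda>s. \<chi> j. g j (s $ j))"
  unfolding vec_lambda_eq_sum_axis
  by (intro smooth_on_sum[OF assms(1)] smooth_on_linear_compose[OF assms(1) bounded_linear_axis]
      smooth_on_compose_linear[OF assms(1) bounded_linear_vec_nth assms(2) assms(3)])

lemma matrix_inv_mat_1: "matrix_inv (mat 1 :: real^'n^'n) = mat 1"
proof -
  have "matrix_inv (mat 1 :: real^'n^'n) ** mat 1 = mat 1"
    unfolding matrix_inv_def by (rule someI2[of _ "mat 1"]) auto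
  then show ?thesis by simp
qed

text \<open>
  The coordinate extrema of \<open>K\<close> are attained, hence lie in the intervals. The box lets the
  volume integrals over an arbitrary compact set be computed over a box on which the
  immersion is still defined.
\<close>

lemma compact_subset_cbox_product_domain:
  fixes I :: "'n::finite \<Rightarrow> real set"
  assumes I: "\<And>j. is_interval (I j)" and K: "compact K" "K \<subseteq> product_domain I"
  obtains a b where "K \<subseteq> cbox a b" "cbox a b \<subseteq> product_domain I"
proof (cases "K = {}")
  case True
  have "cbox (1 :: real^'n) 0 = {}" by (simp add: interval_eq_empty_cart)
  then show ?thesis using True that[of 1 0] by simp
next
  case False
  have cont: "continuous_on K (\<lambda>s. s $ j)" for j by (intro continuous_intros)
  have "\<forall>j. \<exists>x\<in>K. \<forall>s\<in>K. x $ j \<le> s $ j" "\<forall>j. \<exists>x\<in>K. \<forall>s\<in>K. s $ j \<le> x $ j"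
    using continuous_attains_inf[OF K(1) False cont] continuous_attains_sup[OF K(1) False cont] by auto
  then obtain p q where p: "\<And>j. p j \<in> K" "\<And>j s. s \<in> K \<Longrightarrow> p j $ j \<le> s $ j"
    and q: "\<And>j. q j \<in> K" "\<And>j s. s \<in> K \<Longrightarrow> s $ j \<le> q j $ j"
    by metis
  have "K \<subseteq> cbox (\<chi> j. p j $ j) (\<chi> j. q j $ j)"
    using p q by (auto simp: mem_box_cart)
  moreover have "cbox (\<chi> j. p j $ j) (\<chi> j. q j $ j) \<subseteq> product_domain I"
    unfolding product_domain_def
  proof safe
    fix s j assume "s \<in> cbox (\<chi> j. p j $ j) (\<chi> j. q j $ j)"
    then have "p j $ j \<le> s $ j" "s $ j \<le> q j $ j" by (auto simp: mem_box_cart)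
    moreover have "p j $ j \<in> I j" "q j $ j \<in> I j"
      using p(1)[of j] q(1)[of j] K(2) by (auto simp: product_domain_def)
    ultimately show "s $ j \<in> I j" using I[of j] mem_is_interval_1_I by blast
  qed
  ultimately show ?thesis using that by blast
qed

locale product_of_curves =
  fixes \<alpha> :: "'n::finite \<Rightarrow> real \<Rightarrow> complex" and I :: "'n \<Rightarrow> real set"
  assumes curves: "\<And>j. arclength_curve (I j) (\<alpha> j)"
begin

abbreviation "\<Omega> \<equiv> product_domain I"
abbreviation "\<Phi> \<equiv> product_immersion \<alpha>"
abbreviation "T j s \<equiv> velocity (\<alpha> j) (s $ j)" for s :: "real^'n"
abbreviation "\<kappa> j \<equiv> signed_curvature (\<alpha> j)"

lemma open_domain: "open \<Omega>"
  unfolding product_domain_def using curve_open[OF curves] by (intro open_vector_box) auto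

lemma domain_nth: "s \<in> \<Omega> \<Longrightarrow> s $ j \<in> I j"
  by (simp add: product_domain_def)

lemma inner_T: "s \<in> \<Omega> \<Longrightarrow> T j s \<bullet> T j s = 1"
  using inner_velocity[OF curves] domain_nth by blast

lemma has_derivative_immersion:
  assumes "s \<in> \<Omega>"
  shows "(\<Phi> has_derivative (\<lambda>v. \<chi> j. v $ j *\<^sub>R T j s)) (at s)"
proof -
  have "((\<lambda>s. \<chi> j. \<alpha> j (s $ j)) has_derivative (\<lambda>v. \<chi> j. v $ j *\<^sub>R T j s)) (at s)"
    by (intro has_derivative_coordinatewise curve_deriv[OF curves] domain_nth assms)
  then show ?thesis by (simp add: product_immersion_def[abs_def])
qed

lemma frechet_derivative_immersion:
  "s \<in> \<Omega> \<Longrightarrow> frechet_derivative \<Phi> (at s) v = (\<chi> j. v $ j *\<^sub>R T j s)"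
  by (simp add: frechet_derivative_at[OF has_derivative_immersion, symmetric])

lemma partial_deriv_immersion: "s \<in> \<Omega> \<Longrightarrow> partial_deriv k \<Phi> s = axis k (T k s)"
  by (auto simp: partial_deriv_def frechet_derivative_immersion vec_eq_iff axis_def)

lemma immersion_smooth: "smooth_on \<Omega> \<Phi>"
  unfolding product_immersion_def[abs_def]
  by (rule smooth_on_coordinatewise[OF open_domain curve_smooth[OF curves] domain_nth])

lemma induced_metric_immersion: "s \<in> \<Omega> \<Longrightarrow> induced_metric \<Phi> s = mat 1"
  by (auto simp: induced_metric_def partial_deriv_immersion inner_axis_axis inner_T mat_def vec_eq_iff)

lemma lagrangian: "lagrangian_immersion \<Omega> \<Phi>"
  unfolding lagrangian_immersion_def
proof (intro conjI ballI allI open_domain immersion_smooth)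
  fix s assume s: "s \<in> \<Omega>"
  have "T j s \<noteq> 0" for j using inner_T[OF s, of j] by auto
  then show "inj (frechet_derivative \<Phi> (at s))"
    by (auto simp: inj_def frechet_derivative_immersion[OF s] vec_eq_iff)
  fix v w
  show "symplectic_form (frechet_derivative \<Phi> (at s) v) (frechet_derivative \<Phi> (at s) w) = 0"
    by (simp add: symplectic_form_def frechet_derivative_immersion[OF s] inner_vec_def
        vector_scalar_mult_def inner_i_self)
qed

text \<open>
  In each factor the tangent line is spanned by \<open>T j\<close> and the normal line by \<open>\<i> T j\<close>, so the
  normal part is computed factor by factor.
\<close>

lemma normal_part_immersion:
  assumes s: "s \<in> \<Omega>"
  shows "normal_part \<Phi> s w = (\<chi> j. (w $ j \<bullet> (\<i> * T j s)) *\<^sub>R (\<i> * T j s))" (is "_ = ?N")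
  unfolding normal_part_def
proof (rule the_equality)
  have norm_T: "norm (T j s) = 1" for j using inner_T[OF s] by (simp add: norm_eq_1)
  have tangent: "x \<in> tangent_space \<Phi> s \<longleftrightarrow> (\<exists>v::real^'n. x = (\<chi> j. v $ j *\<^sub>R T j s))" for x
    by (auto simp: tangent_space_def frechet_derivative_immersion[OF s])
  have "w - ?N = (\<chi> j. (\<chi> j. w $ j \<bullet> T j s) $ j *\<^sub>R T j s)"
    using complex_frame_expansion[OF norm_T, of "w $ _"]
    by (simp add: vec_eq_iff algebra_simps)
  moreover have "?N \<in> (tangent_space \<Phi> s)\<^sup>\<bottom>"
    by (auto simp: orthogonal_comp_def orthogonal_def tangent inner_vec_def inner_i_self)
  ultimately show "?N \<in> (tangent_space \<Phi> s)\<^sup>\<bottom> \<and> w - ?N \<in> tangent_space \<Phi> s"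
    using tangent by blast
  fix u assume u: "u \<in> (tangent_space \<Phi> s)\<^sup>\<bottom> \<and> w - u \<in> tangent_space \<Phi> s"
  then obtain v :: "real^'n" where v: "w - u = (\<chi> j. v $ j *\<^sub>R T j s)" using tangent by blast
  have uT: "u $ j \<bullet> T j s = 0" for j
  proof -
    have "axis j (T j s) \<in> tangent_space \<Phi> s"
      unfolding tangent by (rule exI[of _ "axis j 1"]) (auto simp: vec_eq_iff axis_def)
    then have "axis j (T j s) \<bullet> u = 0"
      using u by (auto simp: orthogonal_comp_def orthogonal_def)
    then show ?thesis by (simp add: inner_axis inner_commute[of _ u])
  qed
  have "u $ j = ?N $ j" for j
  proof -
    have "w $ j - u $ j = v $ j *\<^sub>R T j s" using v by (simp add: vec_eq_iff)
    then have "w $ j \<bullet> (\<i> * T j s) = u $ j \<bullet> (\<i> * T j s)"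
      by (simp add: diff_eq_eq inner_add_left inner_i_self)
    then show ?thesis
      using complex_frame_expansion[OF norm_T, of "u $ j" j] uT[of j] by simp
  qed
  then show "u = ?N" by (simp add: vec_eq_iff)
qed

lemma has_derivative_partial_immersion:
  assumes "s \<in> \<Omega>"
  shows "(partial_deriv k \<Phi> has_derivative
    (\<lambda>v. axis k (v $ k *\<^sub>R (\<kappa> k (s $ k) *\<^sub>R (\<i> * T k s))))) (at s)"
proof -
  have "((\<lambda>s. T k s) has_derivative (\<lambda>v. v $ k *\<^sub>R (\<kappa> k (s $ k) *\<^sub>R (\<i> * T k s)))) (at s)"
    using has_derivative_compose[OF bounded_linear_imp_has_derivative[OF bounded_linear_vec_nth]
        frenet[OF curves domain_nth[OF assms], unfolded has_vector_derivative_def]] .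
  from bounded_linear.has_derivative[OF bounded_linear_axis this]
  have "((\<lambda>s. axis k (T k s)) has_derivative
    (\<lambda>v. axis k (v $ k *\<^sub>R (\<kappa> k (s $ k) *\<^sub>R (\<i> * T k s))))) (at s)" .
  then show ?thesis
    by (rule has_derivative_transform_within_open[OF _ open_domain assms])
      (simp add: partial_deriv_immersion)
qed

lemma second_partial_immersion:
  "s \<in> \<Omega> \<Longrightarrow> partial_deriv j (partial_deriv k \<Phi>) s =
    (if j = k then axis k (\<kappa> k (s $ k) *\<^sub>R (\<i> * T k s)) else 0)"
  unfolding partial_deriv_def[of j] frechet_derivative_at[OF has_derivative_partial_immersion, symmetric]
  by (auto simp: axis_def vec_eq_iff)

text \<open>
  The metric is Euclidean in arclength coordinates and mixed second derivatives vanish, so the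
  trace is just the sum of the curvature vectors of the factors.
\<close>

lemma mean_curvature_immersion:
  assumes s: "s \<in> \<Omega>"
  shows "mean_curvature \<Phi> s = (\<chi> j. (\<kappa> j (s $ j) / real CARD('n)) *\<^sub>R (\<i> * T j s))"
proof -
  have sff: "second_fundamental_form \<Phi> j j s = axis j (\<kappa> j (s $ j) *\<^sub>R (\<i> * T j s))" for j
    using inner_T[OF s]
    by (auto simp: second_fundamental_form_def normal_part_immersion[OF s]
        second_partial_immersion[OF s] vec_eq_iff axis_def inner_i_times_i_times)
  have "(\<Sum>k\<in>UNIV. (matrix_inv (induced_metric \<Phi> s) $ j $ k) *\<^sub>R second_fundamental_form \<Phi> j k s)
      = axis j (\<kappa> j (s $ j) *\<^sub>R (\<i> * T j s))" for j
    unfolding induced_metric_immersion[OF s] matrix_inv_mat_1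
    by (simp add: mat_def if_distrib[of "\<lambda>c. c *\<^sub>R _"] sff cong: if_cong)
  then have "mean_curvature \<Phi> s
      = (1 / real CARD('n)) *\<^sub>R (\<chi> j. \<kappa> j (s $ j) *\<^sub>R (\<i> * T j s))"
    by (simp add: mean_curvature_def vec_lambda_eq_sum_axis)
  then show ?thesis by (simp add: vec_eq_iff)
qed

text \<open>
  The derivative of \<open>\<kappa> \<i> \<alpha>'\<close> is \<open>\<kappa>' \<i> \<alpha>' - \<kappa>\<^sup>2 \<alpha>'\<close>; the second term is tangent and drops out.
\<close>

lemma normal_derivative_mean_curvature:
  assumes s: "s \<in> \<Omega>"
  shows "normal_part \<Phi> s (partial_deriv k (mean_curvature \<Phi>) s)
    = axis k ((deriv (\<kappa> k) (s $ k) / real CARD('n)) *\<^sub>R (\<i> * T k s))"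
proof -
  let ?D = "\<lambda>j. (\<kappa> j (s $ j) / real CARD('n)) *\<^sub>R (\<i> * (\<kappa> j (s $ j) *\<^sub>R (\<i> * T j s)))
      + (deriv (\<kappa> j) (s $ j) / real CARD('n)) *\<^sub>R (\<i> * T j s)"
  have "((\<lambda>s. \<chi> j. (\<kappa> j (s $ j) / real CARD('n)) *\<^sub>R (\<i> * velocity (\<alpha> j) (s $ j))) has_derivative
      (\<lambda>v. \<chi> j. v $ j *\<^sub>R ?D j)) (at s)"
  proof (rule has_derivative_coordinatewise)
    fix j
    have "((\<lambda>u. \<kappa> j u / real CARD('n)) has_real_derivative deriv (\<kappa> j) (s $ j) / real CARD('n)) (at (s $ j))"
      by (intro DERIV_cdivide curvature_deriv[OF curves] domain_nth s)
    then show "((\<lambda>u. (\<kappa> j u / real CARD('n)) *\<^sub>R (\<i> * velocity (\<alpha> j) u)) has_vector_derivative ?D j) (at (s $ j))"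
      by (intro has_vector_derivative_scaleR frenet[OF curves] domain_nth s
          bounded_linear.has_vector_derivative[OF bounded_linear_mult_right])
  qed
  then have "(mean_curvature \<Phi> has_derivative (\<lambda>v. \<chi> j. v $ j *\<^sub>R ?D j)) (at s)"
    by (rule has_derivative_transform_within_open[OF _ open_domain s])
      (simp add: mean_curvature_immersion)
  then have "partial_deriv k (mean_curvature \<Phi>) s = axis k (?D k)"
    unfolding partial_deriv_def
    by (subst frechet_derivative_at[symmetric], assumption) (auto simp: vec_eq_iff axis_def)
  moreover have "?D j \<bullet> (\<i> * T j s) = deriv (\<kappa> j) (s $ j) / real CARD('n)" for j
    using inner_T[OF s, of j] by (simp add: inner_add_left inner_diff_left inner_i_self inner_i_times_i_times)
  ultimately show ?thesis
    by (auto simp: normal_part_immersion[OF s] vec_eq_iff axis_def)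
qed

lemma parallel_iff_curvatures_constant:
  "parallel_mean_curvature \<Omega> \<Phi> \<longleftrightarrow> (\<forall>j. \<forall>u\<in>I j. deriv (\<kappa> j) u = 0)"
proof -
  have zero: "normal_part \<Phi> s (partial_deriv j (mean_curvature \<Phi>) s) = 0 \<longleftrightarrow> deriv (\<kappa> j) (s $ j) = 0"
    if "s \<in> \<Omega>" for s j
  proof -
    have "T j s \<noteq> 0" using inner_T[OF that, of j] by auto
    then show ?thesis
      by (auto simp: normal_derivative_mean_curvature[OF that] axis_eq_0_iff)
  qed
  have "\<exists>s\<in>\<Omega>. s $ j = u" if "u \<in> I j" for j u
  proof -
    have "\<exists>t. t \<in> I i" for i using curve_nonempty[OF curves] by auto
    then obtain t where "\<And>i. t i \<in> I i" by metis
    then have "(\<chi> i. if i = j then u else t i) \<in> \<Omega>" using that by (auto simp: product_domain_def)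
    then show ?thesis by force
  qed
  then show ?thesis unfolding parallel_mean_curvature_def using zero domain_nth by metis
qed

end

section \<open>First variation of the volume\<close>

lemma Ck_on_1_sqrt: "Ck_on 1 {0<..} sqrt"
  unfolding One_nat_def
proof (rule Ck_on_SucI)
  show "(sqrt has_derivative ((*) (inverse (sqrt x) / 2))) (at x)" if "x \<in> {0<..}" for x
    using DERIV_real_sqrt[of x] that unfolding has_field_derivative_def by simp
  show "Ck_on 0 {0<..} (\<lambda>x. inverse (sqrt x) / 2 * v)" for v
    by (auto intro!: continuous_intros)
qed simp

lemma smooth_on_det:
  fixes A :: "'a::euclidean_space \<Rightarrow> real^'n^'n"
  assumes "open S" "\<And>i j. smooth_on S (\<lambda>x. A x $ i $ j)"
  shows "smooth_on S (\<lambda>x. det (A x))"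
  unfolding det_def
  by (intro smooth_on_sum[OF assms(1)] smooth_on_prod[OF assms(1)] assms(2)
      smooth_on_bilinear[OF assms(1) bounded_bilinear_mult] smooth_on_const)

text \<open>A positive distance from the compact slice to the complement of \<open>W\<close> bounds the time.\<close>

lemma compact_slice_thickening:
  fixes W :: "(real \<times> 'a::euclidean_space) set"
  assumes "open W" "compact B" "{0} \<times> B \<subseteq> W"
  obtains \<delta> where "\<delta> > 0" "{-\<delta>..\<delta>} \<times> B \<subseteq> W"
proof -
  have "compact ({0::real} \<times> B)" by (intro compact_Times assms(2)) simp
  from compact_subset_open_imp_ball_epsilon_subset[OF this assms(1,3)]
  obtain e where e: "e > 0" "(\<Union>z\<in>{0} \<times> B. ball z e) \<subseteq> W" by blast
  have "{-(e/2)..e/2} \<times> B \<subseteq> W"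
  proof
    fix z assume "z \<in> {-(e/2)..e/2} \<times> B"
    then obtain t x where z: "z = (t, x)" "\<bar>t\<bar> \<le> e / 2" "x \<in> B" by auto
    then have "z \<in> ball (0, x) e" using e(1) by (simp add: dist_Pair_Pair)
    then show "z \<in> W" using e(2) z(3) by blast
  qed
  then show ?thesis using that[of "e/2"] e(1) by simp
qed

context product_of_curves
begin

lemma T_smooth: "smooth_on \<Omega> (T j)"
  by (rule smooth_on_compose_linear[OF open_domain bounded_linear_vec_nth
        velocity_smooth[OF curves] domain_nth])

lemma curvature_nth_smooth: "smooth_on \<Omega> (\<lambda>s. \<kappa> j (s $ j))"
  by (rule smooth_on_compose_linear[OF open_domain bounded_linear_vec_nth
        curvature_smooth[OF curves] domain_nth])

lemma integral_divergence_compact_support: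
  assumes K: "compact K" "K \<subseteq> cbox a b" "cbox a b \<subseteq> \<Omega>"
    and smooth: "\<And>j. smooth_on \<Omega> (u j)" and supp: "\<And>j s. s \<in> \<Omega> - K \<Longrightarrow> u j s = (0::real)"
  shows "integral (cbox a b) (\<lambda>s. \<Sum>j\<in>UNIV. partial_deriv j (u j) s) = 0"
proof -
  have "integral (cbox a b) (\<lambda>s. partial_deriv j (u j) s) = 0" for j
    unfolding partial_deriv_def
    by (rule integral_derivative_compact_support[OF open_domain _ K(1)])
      (use K smooth supp in \<open>auto simp: smooth_on_def\<close>)
  moreover have "partial_deriv j (u j) integrable_on cbox a b" for j
    unfolding partial_deriv_def
    by (intro integrable_continuous continuous_on_subset[OF _ K(3)]
        smooth_on_continuous_on smooth_on_frechet_derivative smooth)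
  ultimately show ?thesis by (subst integral_sum) auto
qed

text \<open>
  The first variation formula for an arbitrary variation of compact support. At time \<open>0\<close> the
  metric is the identity, so by Jacobi's formula the volume density has the same time derivative
  as \<open>Q = \<Sum>\<^sub>j \<partial>\<^sub>j\<Phi> \<bullet> \<partial>\<^sub>jG\<close>. For each fixed time, integrating by parts in space turns the integral of
  \<open>Q\<close> into a constant minus the integral of \<open>R = \<Sum>\<^sub>j \<partial>\<^sub>j\<^sub>j\<Phi> \<bullet> (G - \<Phi>)\<close>, which involves no derivative of
  \<open>G\<close>. Only then is the time derivative taken, so that the order of mixed partial derivatives
  of \<open>G\<close> never has to be exchanged.
\<close>

lemma volume_variation:
  assumes K: "compact K" "K \<subseteq> cbox a b" "cbox a b \<subseteq> \<Omega>"
    and \<epsilon>: "\<epsilon> > 0" and G: "smooth_on ({-\<epsilon><..<\<epsilon>} \<times> \<Omega>) (\<lambda>(t, s). G t s)"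
    and supp: "\<And>t s. t \<in> {-\<epsilon><..<\<epsilon>} \<Longrightarrow> s \<in> \<Omega> - K \<Longrightarrow> G t s = \<Phi> s"
    and G0: "\<And>s. s \<in> \<Omega> \<Longrightarrow> G 0 s = \<Phi> s"
  shows "((\<lambda>t. volume_on K (G t)) has_real_derivative
    - integral (cbox a b) (\<lambda>s. \<Sum>j\<in>UNIV.
        \<kappa> j (s $ j) * (vector_derivative (\<lambda>t. G t s) (at 0) $ j \<bullet> (\<i> * T j s)))) (at 0)"
proof -
  define U where "U = {-\<epsilon><..<\<epsilon>} \<times> \<Omega>"
  define H where "H = (\<lambda>(t, s). G t s)"
  define P where "P j z = frechet_derivative H (at z) (0, axis j 1)" for j z
  define D where "D z = det (\<chi> j k. P j z \<bullet> P k z)" for z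
  define Q where "Q z = (\<Sum>j\<in>UNIV. T j (snd z) \<bullet> (P j z $ j))" for z
  define R where "R z = (\<Sum>j\<in>UNIV.
    (\<kappa> j (snd z $ j) *\<^sub>R (\<i> * T j (snd z))) \<bullet> (H z $ j + (-1) *\<^sub>R \<Phi> (snd z) $ j))" for z
  have U: "open U" unfolding U_def by (intro open_Times open_domain) simp
  have H: "smooth_on U H" using G by (simp add: H_def U_def)
  have P: "smooth_on U (P j)" for j
    unfolding P_def by (rule smooth_on_frechet_derivative[OF H])
  have pull: "smooth_on U (\<lambda>z. f (snd z))" if "smooth_on \<Omega> f" for f :: "real^'n \<Rightarrow> 'b::real_normed_vector"
    by (rule smooth_on_compose_linear[OF U bounded_linear_snd that]) (auto simp: U_def)
  have D: "smooth_on U D"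
    unfolding D_def
    by (rule smooth_on_det[OF U]) (simp add: smooth_on_bilinear[OF U bounded_bilinear_inner] P)
  have Q: "smooth_on U Q"
    unfolding Q_def
    by (intro smooth_on_sum[OF U] smooth_on_bilinear[OF U bounded_bilinear_inner]
        smooth_on_linear_compose[OF U bounded_linear_vec_nth] P pull T_smooth)
  have R: "smooth_on U R"
    unfolding R_def
    by (intro smooth_on_sum[OF U] smooth_on_bilinear[OF U bounded_bilinear_inner]
        smooth_on_bilinear[OF U bounded_bilinear_scaleR] smooth_on_add[OF U]
        smooth_on_linear_compose[OF U bounded_linear_vec_nth]
        smooth_on_linear_compose[OF U bounded_linear_mult_right]
        smooth_on_linear_compose[OF U bounded_linear_scaleR_right]
        H pull[OF T_smooth] pull[OF immersion_smooth] pull[OF curvature_nth_smooth])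
  have H0: "H (0, s) = \<Phi> s" if "s \<in> \<Omega>" for s using G0 that by (simp add: H_def)
  have mem: "(t, s) \<in> U" if "\<bar>t\<bar> < \<epsilon>" "s \<in> \<Omega>" for t s using that by (auto simp: U_def)
  have P_eq: "partial_deriv j (G t) s = P j (t, s)" if "\<bar>t\<bar> < \<epsilon>" "s \<in> \<Omega>" for j t s
    using frechet_derivative_slice[OF smooth_on_differentiable[OF H mem[OF that]]]
    by (simp add: partial_deriv_def P_def H_def)
  \<comment> \<open>At time \<open>0\<close>, and off \<open>K\<close> at all times, \<open>G t\<close> and \<open>\<Phi>\<close> agree on an open set, hence to first order.\<close>
  have P_\<Phi>: "P j (t, s) = axis j (T j s)"
    if ts: "\<bar>t\<bar> < \<epsilon>" "s \<in> \<Omega>" and cases: "t = 0 \<or> s \<notin> K" for j t s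
  proof -
    define X where "X = (if t = 0 then \<Omega> else \<Omega> - K)"
    have X: "open X" "s \<in> X" "\<And>s. s \<in> X \<Longrightarrow> \<Phi> s = G t s"
      using open_domain K(1) ts cases G0 supp
      by (auto simp: X_def open_Diff compact_imp_closed abs_less_iff split: if_splits)
    have "\<Phi> differentiable (at s)" using smooth_on_differentiable[OF immersion_smooth ts(2)] .
    from frechet_derivative_transform_within_open[OF this X]
    show ?thesis
      using partial_deriv_immersion[OF ts(2)] P_eq[OF ts] by (simp add: partial_deriv_def)
  qed
  have metric: "(\<chi> j k. P j (t, s) \<bullet> P k (t, s)) = (mat 1 :: real^'n^'n)"
    if "\<bar>t\<bar> < \<epsilon>" "s \<in> \<Omega>" "t = 0 \<or> s \<notin> K" for t s
    by (simp add: P_\<Phi>[OF that] vec_eq_iff mat_def inner_axis_axis inner_T[OF that(2)])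
  have vol: "sqrt (det (induced_metric (G t) s)) = sqrt (D (t, s))" if "\<bar>t\<bar> < \<epsilon>" "s \<in> \<Omega>" for t s
    by (simp add: induced_metric_def P_eq[OF that] D_def)

  \<comment> \<open>The square root is smooth only where the Gram determinant is positive, hence for short times.\<close>
  define W where "W = {z \<in> U. D z > 0}"
  have "open W"
    using continuous_open_preimage[OF smooth_on_continuous_on[OF D] U, of "{0<..}"]
    by (simp add: W_def vimage_def Int_def)
  moreover have "{0} \<times> cbox a b \<subseteq> W"
    using \<epsilon> K(3) mem[of 0] metric[of 0] by (auto simp: W_def D_def)
  ultimately obtain \<delta> where \<delta>: "\<delta> > 0" "{-\<delta>..\<delta>} \<times> cbox a b \<subseteq> W"
    using compact_slice_thickening[of W "cbox a b"] by auto
  then have \<delta>U: "{-\<delta>..\<delta>} \<times> cbox a b \<subseteq> U" by (auto simp: W_def)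
  have "W \<subseteq> U" by (auto simp: W_def)
  have "Ck_on 1 W D" using smooth_on_subset[OF D \<open>W \<subseteq> U\<close>] unfolding smooth_on_def by blast
  then have sqrtD: "Ck_on 1 W (\<lambda>z. sqrt (D z))"
    by (rule Ck_on_compose_real[OF \<open>open W\<close> Ck_on_1_sqrt]) (simp add: W_def)

  have dt: "((\<lambda>t. f (t, s)) has_vector_derivative frechet_derivative f (at (0, s)) (1, 0)) (at 0)"
    if "smooth_on U f" "s \<in> \<Omega>" for f :: "real \<times> (real^'n) \<Rightarrow> 'b::real_normed_vector" and s
    by (rule has_vector_derivative_slice[OF smooth_on_differentiable[OF that(1) mem]])
      (use \<epsilon> that in auto)
  have same_dt: "frechet_derivative (\<lambda>z. sqrt (D z)) (at (0, s)) (1, 0) = frechet_derivative Q (at (0, s)) (1, 0)"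
    if s: "s \<in> cbox a b" for s
  proof -
    have s\<Omega>: "s \<in> \<Omega>" using s K(3) by auto
    define P' where "P' j = frechet_derivative (P j) (at (0, s)) (1, 0)" for j
    have dP: "((\<lambda>t. P j (t, s)) has_vector_derivative P' j) (at 0)" for j
      unfolding P'_def by (rule dt[OF P s\<Omega>])
    have "((\<lambda>t. P j (t, s) \<bullet> P k (t, s)) has_real_derivative P j (0, s) \<bullet> P' k + P' j \<bullet> P k (0, s)) (at 0)" for j k
      using bounded_bilinear.has_vector_derivative[OF bounded_bilinear_inner dP dP]
      by (simp add: has_real_derivative_iff_has_vector_derivative)
    then have "((\<lambda>t. det (\<chi> j k. P j (t, s) \<bullet> P k (t, s))) has_real_derivative
        (\<Sum>j\<in>UNIV. P j (0, s) \<bullet> P' j + P' j \<bullet> P j (0, s))) (at 0)"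
      using metric[of 0 s] \<epsilon> s\<Omega> by (intro DERIV_det_mat_1) auto
    moreover have "D (0, s) = 1" using metric[of 0 s] \<epsilon> s\<Omega> by (simp add: D_def)
    ultimately have "((\<lambda>t. sqrt (D (t, s))) has_real_derivative
        (\<Sum>j\<in>UNIV. P j (0, s) \<bullet> P' j + P' j \<bullet> P j (0, s)) / 2) (at 0)"
      by (auto intro!: derivative_eq_intros simp: D_def)
    also have "(\<Sum>j\<in>UNIV. P j (0, s) \<bullet> P' j + P' j \<bullet> P j (0, s)) / 2 = (\<Sum>j\<in>UNIV. T j s \<bullet> (P' j $ j))"
      using P_\<Phi>[of 0 s] \<epsilon> s\<Omega> by (simp add: inner_axis inner_axis' inner_commute flip: mult_2 sum_distrib_left)
    finally have sqrt_sum: "((\<lambda>t. sqrt (D (t, s))) has_vector_derivative (\<Sum>j\<in>UNIV. T j s \<bullet> (P' j $ j))) (at 0)"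
      by (simp add: has_real_derivative_iff_has_vector_derivative)
    have sqrt_dt: "((\<lambda>t. sqrt (D (t, s))) has_vector_derivative
        frechet_derivative (\<lambda>z. sqrt (D z)) (at (0, s)) (1, 0)) (at 0)"
    proof (rule has_vector_derivative_slice)
      have "(0, s) \<in> W" using \<delta> s by auto
      then show "(\<lambda>z. sqrt (D z)) differentiable (at (0, s))" using sqrtD by simp
    qed
    have Q_sum: "((\<lambda>t. Q (t, s)) has_vector_derivative (\<Sum>j\<in>UNIV. T j s \<bullet> (P' j $ j))) (at 0)"
      unfolding Q_def snd_conv
      by (intro has_vector_derivative_sum bounded_linear.has_vector_derivative[OF bounded_linear_inner_right]
          bounded_linear.has_vector_derivative[OF bounded_linear_vec_nth] dP)
    have Q_dt: "((\<lambda>t. Q (t, s)) has_vector_derivative frechet_derivative Q (at (0, s)) (1, 0)) (at 0)"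
      by (rule dt[OF Q s\<Omega>])
    show ?thesis
      using vector_derivative_unique_at[OF sqrt_sum sqrt_dt] vector_derivative_unique_at[OF Q_sum Q_dt]
      by simp
  qed

  have int: "(\<lambda>s. f (t, s)) integrable_on cbox a b"
    if "\<bar>t\<bar> < \<epsilon>" "smooth_on U f" for f :: "real \<times> (real^'n) \<Rightarrow> real" and t
    by (intro integrable_continuous continuous_on_compose2[OF smooth_on_continuous_on[OF that(2)]])
      (use that K(3) mem in \<open>auto intro!: continuous_intros\<close>)
  \<comment> \<open>The displacement \<open>G t - \<Phi>\<close>, not \<open>G t\<close> itself, has support in \<open>K\<close>; this is the source of the constant.\<close>
  have parts: "integral (cbox a b) (\<lambda>s. Q (t, s))
      = integral (cbox a b) (\<lambda>s. real CARD('n)) - integral (cbox a b) (\<lambda>s. R (t, s))"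
    if t: "\<bar>t\<bar> < \<epsilon>" for t
  proof -
    define u where "u j s = T j s \<bullet> (G t s $ j + (-1) *\<^sub>R \<Phi> s $ j)" for j s
    have Gt: "smooth_on \<Omega> (G t)"
    proof -
      have "smooth_on \<Omega> (\<lambda>s. H (t, s))"
        by (rule smooth_on_compose_affine[OF open_domain _ H mem[OF t]])
          (auto intro!: derivative_eq_intros)
      then show ?thesis by (simp add: H_def)
    qed
    have du: "partial_deriv j (u j) s
        = (\<kappa> j (s $ j) *\<^sub>R (\<i> * T j s)) \<bullet> (G t s $ j - \<Phi> s $ j) + T j s \<bullet> P j (t, s) $ j - 1"
      if s: "s \<in> \<Omega>" for j s
    proof -
      have g: "(G t has_derivative frechet_derivative (G t) (at s)) (at s)"
        by (rule has_frechet_derivative[OF smooth_on_differentiable[OF Gt s]])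
      have \<phi>: "(\<Phi> has_derivative frechet_derivative \<Phi> (at s)) (at s)"
        by (rule has_frechet_derivative[OF smooth_on_differentiable[OF immersion_smooth s]])
      have "((\<lambda>s. T j s) has_derivative (\<lambda>v. v $ j *\<^sub>R (\<kappa> j (s $ j) *\<^sub>R (\<i> * T j s)))) (at s)"
        using has_derivative_compose[OF bounded_linear_imp_has_derivative[OF bounded_linear_vec_nth]
            frenet[OF curves domain_nth[OF s], unfolded has_vector_derivative_def]] .
      from bounded_bilinear.FDERIV[OF bounded_bilinear_inner this has_derivative_add[OF
          bounded_linear.has_derivative[OF bounded_linear_vec_nth[of j] g]
          has_derivative_scaleR_right[OF bounded_linear.has_derivative[OF bounded_linear_vec_nth[of j] \<phi>], of "-1"]]]
      have "(u j has_derivative (\<lambda>v. T j s \<bullet> (frechet_derivative (G t) (at s) v $ j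
            + (-1) *\<^sub>R frechet_derivative \<Phi> (at s) v $ j)
          + (v $ j *\<^sub>R (\<kappa> j (s $ j) *\<^sub>R (\<i> * T j s))) \<bullet> (G t s $ j + (-1) *\<^sub>R \<Phi> s $ j))) (at s)"
        unfolding u_def .
      from frechet_derivative_at[OF this, symmetric]
      show ?thesis
        using P_eq[OF t s, of j] inner_T[OF s, of j] frechet_derivative_immersion[OF s]
        by (simp add: partial_deriv_def inner_add_right inner_diff_right axis_def)
    qed
    have "integral (cbox a b) (\<lambda>s. \<Sum>j\<in>UNIV. partial_deriv j (u j) s) = 0"
    proof (rule integral_divergence_compact_support[OF K])
      show "smooth_on \<Omega> (u j)" for j
        unfolding u_def
        by (intro smooth_on_bilinear[OF open_domain bounded_bilinear_inner] T_smooth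
            smooth_on_add[OF open_domain] smooth_on_linear_compose[OF open_domain bounded_linear_vec_nth]
            smooth_on_linear_compose[OF open_domain bounded_linear_scaleR_right] Gt immersion_smooth)
      show "u j s = 0" if "s \<in> \<Omega> - K" for j s
        using supp[OF _ that, of t] t by (simp add: u_def abs_less_iff)
    qed
    also have "integral (cbox a b) (\<lambda>s. \<Sum>j\<in>UNIV. partial_deriv j (u j) s)
        = integral (cbox a b) (\<lambda>s. Q (t, s) + R (t, s) - real CARD('n))"
      using K(3) by (intro integral_cong)
        (auto simp: du subset_iff Q_def R_def H_def sum.distrib sum_subtractf)
    also have "\<dots> = integral (cbox a b) (\<lambda>s. Q (t, s)) + integral (cbox a b) (\<lambda>s. R (t, s))
        - integral (cbox a b) (\<lambda>s. real CARD('n))"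
      by (simp add: integral_diff integral_add integrable_add int[OF t] Q R integrable_const)
    finally show ?thesis by simp
  qed
  have dR: "frechet_derivative R (at (0, s)) (1, 0)
      = (\<Sum>j\<in>UNIV. \<kappa> j (s $ j) * (vector_derivative (\<lambda>t. G t s) (at 0) $ j \<bullet> (\<i> * T j s)))"
    if s: "s \<in> \<Omega>" for s
  proof -
    have "((\<lambda>t. G t s) has_vector_derivative vector_derivative (\<lambda>t. G t s) (at 0)) (at 0)"
      using dt[OF H s] differentiableI_vector vector_derivative_works by (fastforce simp: H_def)
    then have "((\<lambda>t. \<Sum>j\<in>UNIV. (\<kappa> j (s $ j) *\<^sub>R (\<i> * T j s)) \<bullet> (G t s $ j + (-1) *\<^sub>R \<Phi> s $ j)) has_vector_derivative
        (\<Sum>j\<in>UNIV. (\<kappa> j (s $ j) *\<^sub>R (\<i> * T j s)) \<bullet> (vector_derivative (\<lambda>t. G t s) (at 0) $ j + 0))) (at 0)"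
      by (intro has_vector_derivative_sum bounded_linear.has_vector_derivative[OF bounded_linear_inner_right]
          has_vector_derivative_add bounded_linear.has_vector_derivative[OF bounded_linear_vec_nth]
          has_vector_derivative_const)
    then have "((\<lambda>t. R (t, s)) has_vector_derivative
        (\<Sum>j\<in>UNIV. \<kappa> j (s $ j) * (vector_derivative (\<lambda>t. G t s) (at 0) $ j \<bullet> (\<i> * T j s)))) (at 0)"
      by (simp add: R_def H_def inner_commute)
    then show ?thesis using dt[OF R s] vector_derivative_unique_at by blast
  qed

  have "((\<lambda>t. integral (cbox a b) (\<lambda>s. Q (t, s))) has_real_derivative
      - integral (cbox a b) (\<lambda>s. frechet_derivative R (at (0, s)) (1, 0))) (at 0)"
  proof (rule has_field_derivative_transform_within_open[where S = "{-\<epsilon><..<\<epsilon>}"])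
    have "Ck_on 1 U R" using R smooth_on_def by blast
    from leibniz_rule_smooth[OF U this \<delta>(1) \<delta>U]
    show "((\<lambda>t. integral (cbox a b) (\<lambda>s. real CARD('n)) - integral (cbox a b) (\<lambda>s. R (t, s)))
        has_real_derivative - integral (cbox a b) (\<lambda>s. frechet_derivative R (at (0, s)) (1, 0))) (at 0)"
      by (auto intro!: derivative_eq_intros)
  qed (use \<epsilon> parts in \<open>auto simp: abs_less_iff\<close>)
  moreover have "((\<lambda>t. integral (cbox a b) (\<lambda>s. Q (t, s))) has_real_derivative
      integral (cbox a b) (\<lambda>s. frechet_derivative Q (at (0, s)) (1, 0))) (at 0)"
    by (rule leibniz_rule_smooth[OF U _ \<delta>(1) \<delta>U]) (use Q smooth_on_def in blast)
  ultimately have E': "integral (cbox a b) (\<lambda>s. frechet_derivative Q (at (0, s)) (1, 0))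
      = - integral (cbox a b) (\<lambda>s. \<Sum>j\<in>UNIV.
        \<kappa> j (s $ j) * (vector_derivative (\<lambda>t. G t s) (at 0) $ j \<bullet> (\<i> * T j s)))"
    using DERIV_unique K(3) dR by (simp add: subset_iff cong: integral_cong)

  have "((\<lambda>t. integral (cbox a b) (\<lambda>s. sqrt (D (t, s)))) has_real_derivative
      integral (cbox a b) (\<lambda>s. frechet_derivative (\<lambda>z. sqrt (D z)) (at (0, s)) (1, 0))) (at 0)"
    by (rule leibniz_rule_smooth[OF \<open>open W\<close> sqrtD \<delta>])
  also have "integral (cbox a b) (\<lambda>s. frechet_derivative (\<lambda>z. sqrt (D z)) (at (0, s)) (1, 0))
      = integral (cbox a b) (\<lambda>s. frechet_derivative Q (at (0, s)) (1, 0))"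
    by (rule integral_cong) (rule same_dt)
  finally have E: "((\<lambda>t. integral (cbox a b) (\<lambda>s. sqrt (D (t, s)))) has_real_derivative
      integral (cbox a b) (\<lambda>s. frechet_derivative Q (at (0, s)) (1, 0))) (at 0)" .

  have K_int: "indicat_real K integrable_on cbox a b"
    using K(1) by (simp add: integrable_on_indicator lmeasurable_compact compact_Int)
  \<comment> \<open>Off \<open>K\<close> the density is \<open>1\<close>, so replacing \<open>K\<close> by the box changes the volume by a constant.\<close>
  have box: "volume_on K (G t) = integral (cbox a b) (\<lambda>s. sqrt (D (t, s)))
      + (integral (cbox a b) (indicat_real K) - integral (cbox a b) (\<lambda>s. 1))"
    if t: "\<bar>t\<bar> < min \<epsilon> \<delta>" for t
  proof -
    have "volume_on K (G t) = integral (cbox a b) (\<lambda>s. if s \<in> K then sqrt (D (t, s)) else 0)"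
      using vol[of t] t K by (auto simp: volume_on_def integral_restrict_Int Int_absorb2 intro!: integral_cong)
    also have "\<dots> = integral (cbox a b) (\<lambda>s. sqrt (D (t, s)) + (indicat_real K s - 1))"
      using metric[of t] t K(3) by (intro integral_cong) (auto simp: D_def indicator_def subset_iff)
    also have "\<dots> = integral (cbox a b) (\<lambda>s. sqrt (D (t, s)))
        + (integral (cbox a b) (indicat_real K) - integral (cbox a b) (\<lambda>s. 1))"
    proof -
      have "(\<lambda>s. sqrt (D (t, s))) integrable_on cbox a b"
        using t K(3) mem
        by (intro integrable_continuous continuous_on_real_sqrt
            continuous_on_compose2[OF smooth_on_continuous_on[OF D]])
          (auto intro!: continuous_intros)
      then show ?thesis
        by (simp add: integral_add integral_diff integrable_diff K_int integrable_const)
    qed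
    finally show ?thesis .
  qed
  have "((\<lambda>t. volume_on K (G t)) has_real_derivative
      integral (cbox a b) (\<lambda>s. frechet_derivative Q (at (0, s)) (1, 0))) (at 0)"
  proof (rule has_field_derivative_transform_within_open[where S = "ball 0 (min \<epsilon> \<delta>)"])
    show "((\<lambda>t. integral (cbox a b) (\<lambda>s. sqrt (D (t, s)))
      + (integral (cbox a b) (indicat_real K) - integral (cbox a b) (\<lambda>s. 1))) has_real_derivative
      integral (cbox a b) (\<lambda>s. frechet_derivative Q (at (0, s)) (1, 0))) (at 0)"
      using DERIV_add[OF E DERIV_const] by simp
  qed (use \<epsilon> \<delta> box in auto)
  then show ?thesis unfolding E' .
qed


text \<open>
  The Lagrangian angle of the product is the sum of the tangent angles of the curves up to a
  constant. The derivative of a tangent angle is the curvature and the metric is Euclidean, so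
  this sum is the Laplacian of the Lagrangian angle.
\<close>

abbreviation "angle_laplacian s \<equiv> \<Sum>j\<in>UNIV. deriv (\<kappa> j) (s $ j)" for s :: "real^'n"

lemma angle_laplacian_continuous: "continuous_on \<Omega> (\<lambda>s. angle_laplacian s)"
proof -
  have "smooth_on (I j) (deriv (\<kappa> j))" for j
  proof -
    have "vector_derivative (\<kappa> j) (at u) = deriv (\<kappa> j) u" if "u \<in> I j" for u
      using curvature_deriv[OF curves that]
      by (simp add: has_real_derivative_iff_has_vector_derivative vector_derivative_at)
    then show ?thesis
      by (intro smooth_on_cong[OF curve_open[OF curves], THEN iffD1,
            OF _ smooth_on_vector_derivative[OF curve_open[OF curves] curvature_smooth[OF curves]]])
  qed
  then have "smooth_on \<Omega> (\<lambda>s. deriv (\<kappa> j) (s $ j))" for j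
    by (rule smooth_on_compose_linear[OF open_domain bounded_linear_vec_nth _ domain_nth])
  then show ?thesis by (intro continuous_on_sum smooth_on_continuous_on)
qed

text \<open>
  The Hamiltonian condition says that the component of the variation field along \<open>\<i> T j\<close> is
  \<open>- \<partial>\<^sub>jf\<close>. A second integration by parts moves this derivative from \<open>f\<close> to the curvatures.
\<close>

lemma hamiltonian_volume_variation:
  assumes K: "compact K" "K \<subseteq> cbox a b" "cbox a b \<subseteq> \<Omega>"
    and \<epsilon>: "\<epsilon> > 0" and G: "smooth_on ({-\<epsilon><..<\<epsilon>} \<times> \<Omega>) (\<lambda>(t, s). G t s)"
    and supp: "\<And>t s. t \<in> {-\<epsilon><..<\<epsilon>} \<Longrightarrow> s \<in> \<Omega> - K \<Longrightarrow> G t s = \<Phi> s"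
    and G0: "\<And>s. s \<in> \<Omega> \<Longrightarrow> G 0 s = \<Phi> s"
    and f: "smooth_on \<Omega> f" "\<And>s. s \<in> \<Omega> - K \<Longrightarrow> f s = 0"
    and ham: "\<And>s v. s \<in> \<Omega> \<Longrightarrow> symplectic_form (vector_derivative (\<lambda>t. G t s) (at 0))
      (frechet_derivative \<Phi> (at s) v) = frechet_derivative f (at s) v"
  shows "((\<lambda>t. volume_on K (G t)) has_real_derivative
    integral (cbox a b) (\<lambda>s. - angle_laplacian s * f s)) (at 0)"
proof -
  have df: "vector_derivative (\<lambda>t. G t s) (at 0) $ j \<bullet> (\<i> * T j s) = - partial_deriv j f s"
    if "s \<in> \<Omega>" for s j
  proof -
    have "frechet_derivative \<Phi> (at s) (axis j 1) = axis j (T j s)"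
      using partial_deriv_immersion[OF that] by (simp add: partial_deriv_def)
    then have "partial_deriv j f s
        = (\<i> *s vector_derivative (\<lambda>t. G t s) (at 0)) \<bullet> axis j (T j s)"
      using ham[OF that, of "axis j 1"] by (simp add: partial_deriv_def symplectic_form_def)
    then show ?thesis by (simp add: inner_axis inner_i_left)
  qed
  define u where "u j s = \<kappa> j (s $ j) * f s" for j s
  have u: "smooth_on \<Omega> (u j)" for j
    unfolding u_def
    by (intro smooth_on_bilinear[OF open_domain bounded_bilinear_mult] curvature_nth_smooth f)
  have du: "partial_deriv j (u j) s = \<kappa> j (s $ j) * partial_deriv j f s + deriv (\<kappa> j) (s $ j) * f s"
    if s: "s \<in> \<Omega>" for j s
  proof -
    have "((\<lambda>s. \<kappa> j (s $ j)) has_derivative (\<lambda>v. deriv (\<kappa> j) (s $ j) * v $ j)) (at s)"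
      using has_derivative_compose[OF bounded_linear_imp_has_derivative[OF bounded_linear_vec_nth]
          curvature_deriv[OF curves domain_nth[OF s], unfolded has_field_derivative_def]] .
    from has_derivative_mult[OF this has_frechet_derivative[OF smooth_on_differentiable[OF f(1) s]]]
    have "(u j has_derivative (\<lambda>v. \<kappa> j (s $ j) * frechet_derivative f (at s) v
        + deriv (\<kappa> j) (s $ j) * v $ j * f s)) (at s)"
      unfolding u_def .
    from frechet_derivative_at[OF this, symmetric] show ?thesis
      by (simp add: partial_deriv_def axis_def)
  qed
  have cont: "continuous_on (cbox a b) (\<lambda>s. angle_laplacian s * f s)"
    by (intro continuous_on_mult continuous_on_subset[OF angle_laplacian_continuous K(3)]
        continuous_on_subset[OF smooth_on_continuous_on[OF f(1)] K(3)])
  have contu: "continuous_on (cbox a b) (\<lambda>s. \<Sum>j\<in>UNIV. partial_deriv j (u j) s)"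
    unfolding partial_deriv_def
    by (intro continuous_on_sum continuous_on_subset[OF _ K(3)] smooth_on_continuous_on
        smooth_on_frechet_derivative u)
  have "- integral (cbox a b) (\<lambda>s. \<Sum>j\<in>UNIV.
        \<kappa> j (s $ j) * (vector_derivative (\<lambda>t. G t s) (at 0) $ j \<bullet> (\<i> * T j s)))
      = integral (cbox a b) (\<lambda>s. (\<Sum>j\<in>UNIV. partial_deriv j (u j) s) - angle_laplacian s * f s)"
    unfolding integral_neg[symmetric]
    by (rule integral_cong)
      (use K(3) in \<open>simp add: subset_iff df du sum.distrib sum_distrib_right sum_negf\<close>)
  also have "\<dots> = integral (cbox a b) (\<lambda>s. \<Sum>j\<in>UNIV. partial_deriv j (u j) s)
      - integral (cbox a b) (\<lambda>s. angle_laplacian s * f s)"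
    by (intro integral_diff integrable_continuous cont contu)
  also have "integral (cbox a b) (\<lambda>s. \<Sum>j\<in>UNIV. partial_deriv j (u j) s) = 0"
    by (rule integral_divergence_compact_support[OF K u]) (simp add: u_def f)
  finally show ?thesis
    using volume_variation[OF K \<epsilon> G supp G0] by simp
qed

lemma H_minimal_if_laplacian_zero:
  assumes "\<And>s. s \<in> \<Omega> \<Longrightarrow> angle_laplacian s = 0"
  shows "H_minimal \<Omega> \<Phi>"
  unfolding H_minimal_def
proof (intro conjI allI impI lagrangian)
  fix K G assume "hamiltonian_variation \<Omega> \<Phi> K G"
  then obtain \<epsilon> f where K: "compact K" "K \<subseteq> \<Omega>"
    and \<epsilon>: "\<epsilon> > 0" and G: "smooth_on ({-\<epsilon><..<\<epsilon>} \<times> \<Omega>) (\<lambda>(t, s). G t s)"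
    and supp: "\<And>t s. t \<in> {-\<epsilon><..<\<epsilon>} \<Longrightarrow> s \<in> \<Omega> - K \<Longrightarrow> G t s = \<Phi> s"
    and G0: "\<And>s. s \<in> \<Omega> \<Longrightarrow> G 0 s = \<Phi> s"
    and f: "smooth_on \<Omega> f" "\<And>s. s \<in> \<Omega> - K \<Longrightarrow> f s = 0"
    and ham: "\<And>s v. s \<in> \<Omega> \<Longrightarrow> symplectic_form (vector_derivative (\<lambda>t. G t s) (at 0))
      (frechet_derivative \<Phi> (at s) v) = frechet_derivative f (at s) v"
    unfolding hamiltonian_variation_def by blast
  have "is_interval (I j)" for j using curves[of j] by (simp add: arclength_curve_def)
  then obtain a b where ab: "K \<subseteq> cbox a b" "cbox a b \<subseteq> \<Omega>"
    using compact_subset_cbox_product_domain[of I, OF _ K] by blast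
  have "integral (cbox a b) (\<lambda>s. - angle_laplacian s * f s) = integral (cbox a b) (\<lambda>s. 0)"
    by (rule integral_cong) (use ab assms in auto)
  then show "((\<lambda>t. volume_on K (G t)) has_real_derivative 0) (at 0)"
    using hamiltonian_volume_variation[OF K(1) ab \<epsilon> G supp G0 f ham] by simp
qed

text \<open>
  The straight-line variation along the normal field \<open>V = - \<Sum>\<^sub>j \<partial>\<^sub>jf \<i> T j\<close> has \<open>f\<close> as its
  Hamiltonian, since \<open>\<i> V\<close> is then the tangent vector that represents \<open>df\<close>.
\<close>

lemma exists_hamiltonian_variation:
  assumes f: "smooth_on \<Omega> f" "\<And>s. s \<in> \<Omega> - K \<Longrightarrow> f s = 0" and K: "compact K" "K \<subseteq> \<Omega>"
  obtains G where "smooth_on ({-1<..<1} \<times> \<Omega>) (\<lambda>(t, s). G t s)"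
    "\<And>t s. s \<in> \<Omega> - K \<Longrightarrow> G t s = \<Phi> s" "\<And>s. G 0 s = \<Phi> s"
    "\<And>s v. s \<in> \<Omega> \<Longrightarrow> symplectic_form (vector_derivative (\<lambda>t. G t s) (at 0))
      (frechet_derivative \<Phi> (at s) v) = frechet_derivative f (at s) v"
proof
  define V where "V s = (\<chi> j. (- partial_deriv j f s) *\<^sub>R (\<i> * T j s))" for s
  define G where "G t s = \<Phi> s + t *\<^sub>R V s" for t s
  have V: "smooth_on \<Omega> V"
    unfolding V_def vec_lambda_eq_sum_axis partial_deriv_def
    by (intro smooth_on_sum[OF open_domain] smooth_on_linear_compose[OF open_domain bounded_linear_axis]
        smooth_on_bilinear[OF open_domain bounded_bilinear_scaleR]
        smooth_on_linear_compose[OF open_domain bounded_linear_minus[OF bounded_linear_ident]]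
        smooth_on_linear_compose[OF open_domain bounded_linear_mult_right]
        smooth_on_frechet_derivative f T_smooth)
  have open_U: "open ({-1<..<1::real} \<times> \<Omega>)" by (intro open_Times open_domain) simp
  have "smooth_on ({-1<..<1} \<times> \<Omega>) (\<lambda>z. \<Phi> (snd z) + fst z *\<^sub>R V (snd z))"
    by (intro smooth_on_add[OF open_U] smooth_on_bilinear[OF open_U bounded_bilinear_scaleR]
        smooth_on_linear bounded_linear_fst
        smooth_on_compose_linear[OF open_U bounded_linear_snd immersion_smooth]
        smooth_on_compose_linear[OF open_U bounded_linear_snd V]) auto
  moreover have "(\<lambda>(t, s). G t s) = (\<lambda>z. \<Phi> (snd z) + fst z *\<^sub>R V (snd z))"
    by (auto simp: G_def)
  ultimately show "smooth_on ({-1<..<1} \<times> \<Omega>) (\<lambda>(t, s). G t s)" by simp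
  show "G t s = \<Phi> s" if s: "s \<in> \<Omega> - K" for t s
  proof -
    have "open (\<Omega> - K)" using K open_domain by (simp add: open_Diff compact_imp_closed)
    then have "frechet_derivative (\<lambda>_. 0) (at s) = frechet_derivative f (at s)"
      by (rule frechet_derivative_transform_within_open[OF differentiable_const _ s]) (simp add: f)
    then have "frechet_derivative f (at s) = (\<lambda>_. 0)" by simp
    then have "V s = 0" by (simp add: V_def partial_deriv_def vec_eq_iff)
    then show ?thesis by (simp add: G_def)
  qed
  show "G 0 s = \<Phi> s" for s by (simp add: G_def)
  show "symplectic_form (vector_derivative (\<lambda>t. G t s) (at 0)) (frechet_derivative \<Phi> (at s) v)
      = frechet_derivative f (at s) v" if s: "s \<in> \<Omega>" for s v
  proof -
    have "((\<lambda>t. G t s) has_vector_derivative V s) (at 0)"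
      unfolding G_def by (auto intro!: derivative_eq_intros)
    then have "symplectic_form (vector_derivative (\<lambda>t. G t s) (at 0)) (frechet_derivative \<Phi> (at s) v)
        = (\<Sum>j\<in>UNIV. v $ j * partial_deriv j f s)"
      using inner_T[OF s]
      by (simp add: vector_derivative_at symplectic_form_def frechet_derivative_immersion[OF s]
          inner_vec_def V_def inner_i_left inner_i_times_i_times mult.commute)
    also have "\<dots> = frechet_derivative f (at s) (\<Sum>j\<in>UNIV. v $ j *\<^sub>R axis j 1)"
      using linear_frechet_derivative[OF smooth_on_differentiable[OF f(1) s]]
      by (simp add: partial_deriv_def linear_sum linear_cmul)
    also have "(\<Sum>j\<in>UNIV. v $ j *\<^sub>R axis j 1) = v"
      by (simp add: vec_eq_iff axis_def if_distrib cong: if_cong)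
    finally show ?thesis .
  qed
qed

text \<open>
  If the Laplacian were nonzero at \<open>s0\<close>, a bump function supported where it keeps its sign would
  be the Hamiltonian of a variation with nonzero first variation of volume.
\<close>

lemma laplacian_zero_if_H_minimal:
  assumes "H_minimal \<Omega> \<Phi>" and s0: "s0 \<in> \<Omega>"
  shows "angle_laplacian s0 = 0"
proof (rule ccontr)
  assume nz: "angle_laplacian s0 \<noteq> 0"
  define c where "c = angle_laplacian s0"
  define W where "W = {s \<in> \<Omega>. c * angle_laplacian s > 0}"
  have "continuous_on \<Omega> (\<lambda>s. c * angle_laplacian s)"
    by (intro continuous_on_mult continuous_on_const angle_laplacian_continuous)
  from continuous_open_preimage[OF this open_domain, of "{0<..}"]
  have "open W" by (simp add: W_def vimage_def Int_def)
  moreover have "s0 \<in> W" using s0 nz by (auto simp: W_def c_def zero_less_mult_iff)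
  ultimately obtain a b where ab: "cbox a b \<subseteq> W" "s0 \<in> box a b" "\<forall>i\<in>Basis. a \<bullet> i < b \<bullet> i"
    by (rule open_contains_cbox)
  obtain r where r: "r > 0" "cball s0 r \<subseteq> box a b"
    using open_contains_cball ab(2) open_box by blast
  then have K: "compact (cball s0 r)" "cball s0 r \<subseteq> cbox a b" "cbox a b \<subseteq> \<Omega>"
    using ab(1) box_subset_cbox[of a b] by (auto simp: W_def)
  obtain f :: "real^'n \<Rightarrow> real" where bump: "smooth_on UNIV f" "\<And>s. f s \<ge> 0" "f s0 > 0"
    "\<And>s. s \<notin> cball s0 r \<Longrightarrow> f s = 0"
    using exists_smooth_bump[OF r(1)] by blast
  have f: "smooth_on \<Omega> f" "\<And>s. s \<in> \<Omega> - cball s0 r \<Longrightarrow> f s = 0"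
    using smooth_on_subset[OF bump(1)] bump(4) by auto
  obtain G where G: "smooth_on ({-1<..<1} \<times> \<Omega>) (\<lambda>(t, s). G t s)"
    "\<And>t s. s \<in> \<Omega> - cball s0 r \<Longrightarrow> G t s = \<Phi> s" "\<And>s. G 0 s = \<Phi> s"
    "\<And>s v. s \<in> \<Omega> \<Longrightarrow> symplectic_form (vector_derivative (\<lambda>t. G t s) (at 0))
      (frechet_derivative \<Phi> (at s) v) = frechet_derivative f (at s) v"
    using exists_hamiltonian_variation[OF f K(1)] K(2,3) by blast
  have "hamiltonian_variation \<Omega> \<Phi> (cball s0 r) G"
    unfolding hamiltonian_variation_def
    using K G f by (intro conjI exI[of _ "1::real"] exI[of _ f]) auto
  then have "((\<lambda>t. volume_on (cball s0 r) (G t)) has_real_derivative 0) (at 0)"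
    using assms(1) by (simp add: H_minimal_def)
  moreover have "((\<lambda>t. volume_on (cball s0 r) (G t)) has_real_derivative
      integral (cbox a b) (\<lambda>s. - angle_laplacian s * f s)) (at 0)"
    using G f K by (intro hamiltonian_volume_variation[OF K, of 1]) auto
  ultimately have "integral (cbox a b) (\<lambda>s. - angle_laplacian s * f s) = 0"
    using DERIV_unique by blast
  then have "- c * integral (cbox a b) (\<lambda>s. - angle_laplacian s * f s) = 0" by simp
  then have int0: "integral (cbox a b) (\<lambda>s. c * angle_laplacian s * f s) = 0"
    by (subst (asm) integral_mult_right[symmetric]) (simp add: mult.assoc)
  \<comment> \<open>The factor \<open>c\<close> makes the integrand nonnegative whatever the sign of the Laplacian at \<open>s0\<close>.\<close>
  have "\<forall>s\<in>cbox a b. c * angle_laplacian s * f s = 0"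
  proof (subst integral_cbox_eq_0_iff[symmetric])
    show "continuous_on (cbox a b) (\<lambda>s. c * angle_laplacian s * f s)"
      by (intro continuous_on_mult continuous_on_const
          continuous_on_subset[OF angle_laplacian_continuous K(3)]
          continuous_on_subset[OF smooth_on_continuous_on[OF f(1)] K(3)])
    show "c * angle_laplacian s * f s \<ge> 0" if "s \<in> cbox a b" for s
    proof -
      have "c * angle_laplacian s > 0" using ab(1) that by (auto simp: W_def)
      then show ?thesis using bump(2)[of s] less_imp_le mult_nonneg_nonneg by blast
    qed
  qed (use ab int0 in auto)
  then have "c * angle_laplacian s0 * f s0 = 0" using ab(2) box_subset_cbox by blast
  then show False using bump(3) nz by (simp add: c_def)
qed

text \<open>
  A sum of functions of separate variables is constant only if each of them is: vary one
  coordinate and keep the others at a base point.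
\<close>

lemma laplacian_zero_iff:
  "(\<forall>s\<in>\<Omega>. angle_laplacian s = 0) \<longleftrightarrow>
    (\<exists>l. (\<forall>j. \<forall>u\<in>I j. deriv (\<kappa> j) u = l j) \<and> (\<Sum>j\<in>UNIV. l j) = 0)"
proof
  assume zero: "\<forall>s\<in>\<Omega>. angle_laplacian s = 0"
  have "\<exists>t. t \<in> I i" for i using curve_nonempty[OF curves] by auto
  then obtain t where t: "\<And>i. t i \<in> I i" by metis
  have "(\<Sum>j\<in>UNIV. deriv (\<kappa> j) (t j)) = 0"
    using zero[rule_format, of "\<chi> i. t i"] t by (simp add: product_domain_def)
  moreover have "deriv (\<kappa> j) u = deriv (\<kappa> j) (t j)" if "u \<in> I j" for j u
  proof -
    have "(\<Sum>i\<in>UNIV. deriv (\<kappa> i) (if i = j then u else t i)) = 0"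
      using zero[rule_format, of "\<chi> i. if i = j then u else t i"] t that
      by (simp add: product_domain_def)
    then have "deriv (\<kappa> j) u + (\<Sum>i\<in>UNIV-{j}. deriv (\<kappa> i) (t i)) = 0"
      by (simp add: sum.remove[of UNIV j])
    moreover have "deriv (\<kappa> j) (t j) + (\<Sum>i\<in>UNIV-{j}. deriv (\<kappa> i) (t i)) = 0"
      using \<open>(\<Sum>j\<in>UNIV. deriv (\<kappa> j) (t j)) = 0\<close> by (simp add: sum.remove[of UNIV j])
    ultimately show ?thesis by linarith
  qed
  ultimately show "\<exists>l. (\<forall>j. \<forall>u\<in>I j. deriv (\<kappa> j) u = l j) \<and> (\<Sum>j\<in>UNIV. l j) = 0"
    by (intro exI[of _ "\<lambda>j. deriv (\<kappa> j) (t j)"]) auto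
next
  assume "\<exists>l. (\<forall>j. \<forall>u\<in>I j. deriv (\<kappa> j) u = l j) \<and> (\<Sum>j\<in>UNIV. l j) = 0"
  then show "\<forall>s\<in>\<Omega>. angle_laplacian s = 0" using domain_nth by auto
qed

end

theorem corollary1:
  fixes \<alpha> :: "'n::finite \<Rightarrow> real \<Rightarrow> complex" and I :: "'n \<Rightarrow> real set"
  assumes "\<And>j. arclength_curve (I j) (\<alpha> j)"
  shows "(parallel_mean_curvature (product_domain I) (product_immersion \<alpha>) \<longleftrightarrow>
            (\<forall>j. is_circle_on (I j) (\<alpha> j) \<or> is_line_on (I j) (\<alpha> j))) \<and>
         (H_minimal (product_domain I) (product_immersion \<alpha>) \<longleftrightarrow>
            (\<exists>l :: 'n \<Rightarrow> real.
               (\<forall>j. ((is_circle_on (I j) (\<alpha> j) \<or> is_line_on (I j) (\<alpha> j)) \<and> l j = 0) \<or>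
                    is_cornu_spiral_on (l j) (I j) (\<alpha> j)) \<and>
               (\<Sum>j\<in>UNIV. l j) = 0))"
proof -
  interpret product_of_curves \<alpha> I by unfold_locales (rule assms)
  have "parallel_mean_curvature \<Omega> \<Phi> \<longleftrightarrow> (\<forall>j. is_circle_on (I j) (\<alpha> j) \<or> is_line_on (I j) (\<alpha> j))"
    unfolding parallel_iff_curvatures_constant affine_curvature_iff[OF assms, symmetric]
    by (simp add: is_cornu_spiral_on_def)
  moreover have "H_minimal \<Omega> \<Phi> \<longleftrightarrow> (\<forall>s\<in>\<Omega>. angle_laplacian s = 0)"
    using H_minimal_if_laplacian_zero laplacian_zero_if_H_minimal by blast
  ultimately show ?thesis
    unfolding laplacian_zero_iff affine_curvature_iff[OF assms] by blast
qed

end
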